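(* Every simple (finite-dimensional) formally real Jordan algebra admits a Jordan-Einstein metric.
   Context: A (real) Jordan algebra is a real vector space $\mathscr{A}$ with a bilinear product satisfying $XY=YX$ and $X(X^2Y)=X^2(XY)$. It is simple if $\mathscr{A}^2\ne0$ and it has no nontrivial ideals. It is formally real if it has an identity element and $X^2+Y^2=0$ implies $X=Y=0$. Given an arbitrary (positive definite) inner product $\langle\cdot,\cdot\rangle$ on $\mathscr{A}$, the Jordan-Levi-Civita connection is the unique bilinear map $(X,Y)\mapsto\nabla_XY$ with $\nabla_XY+\nabla_YX=XY$ and $\langle\nabla_XY,Z\rangle=\langle Y,\nabla_XZ\rangle$ for all $X,Y,Z$; explicitly $\langle\nabla_XY,Z\rangle=\frac12(\langle XY,Z\rangle-\langle YZ,X\rangle+\langle ZX,Y\rangle)$. The Jordan curvature tensor is $R(X,Y)Z=-\nabla_X\nabla_YZ-\nabla_Y\nabla_XZ+\nabla_{XY}Z$. Put $\operatorname{ric}(U,V)=\operatorname{Tr}(X\mapsto R(U,X)V)$ and $\operatorname{Ric}(U,V)=\frac12(\operatorname{ric}(U,V)+\operatorname{ric}(V,U))$. The inner product $\langle\cdot,\cdot\rangle$ is a Jordan-Einstein metric on $\mathscr{A}$ if $\operatorname{Ric}=c\langle\cdot,\cdot\rangle$ for some constant $c\in\mathbb{R}$. *)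

theory Defs
  imports "HOL-Analysis.Analysis"
begin

text \<open>
  The underlying vector space of an algebra is a whole type of class \<^class>\<open>real_vector\<close>; the product
  is an explicit bilinear map \<open>m\<close>. This class carries no norm or topology, so the inner product
  \<open>g\<close> below is unrelated to any built-in one.
\<close>

definition fin_dim :: "'a::real_vector itself \<Rightarrow> bool" where
  "fin_dim _ \<longleftrightarrow> (\<exists>B::'a set. finite B \<and> span B = UNIV)"

definition jordan_algebra :: "('a::real_vector \<Rightarrow> 'a \<Rightarrow> 'a) \<Rightarrow> bool" where
  "jordan_algebra m \<longleftrightarrow> bilinear m \<and>
     (\<forall>x y. m x y = m y x) \<and>
     (\<forall>x y. m x (m (m x x) y) = m (m x x) (m x y))"

definition algebra_ideal :: "('a::real_vector \<Rightarrow> 'a \<Rightarrow> 'a) \<Rightarrow> 'a set \<Rightarrow> bool" where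
  "algebra_ideal m I \<longleftrightarrow> subspace I \<and> (\<forall>x. \<forall>y\<in>I. m x y \<in> I \<and> m y x \<in> I)"

definition simple_algebra :: "('a::real_vector \<Rightarrow> 'a \<Rightarrow> 'a) \<Rightarrow> bool" where
  "simple_algebra m \<longleftrightarrow> span {m x y |x y. True} \<noteq> {0} \<and>
     (\<forall>I. algebra_ideal m I \<longrightarrow> I = {0} \<or> I = UNIV)"

definition formally_real :: "('a::real_vector \<Rightarrow> 'a \<Rightarrow> 'a) \<Rightarrow> bool" where
  "formally_real m \<longleftrightarrow> (\<exists>e. \<forall>x. m e x = x \<and> m x e = x) \<and>
     (\<forall>x y. m x x + m y y = 0 \<longrightarrow> x = 0 \<and> y = 0)"

definition inner_product :: "('a::real_vector \<Rightarrow> 'a \<Rightarrow> real) \<Rightarrow> bool" where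
  "inner_product g \<longleftrightarrow> bilinear g \<and> (\<forall>x y. g x y = g y x) \<and> (\<forall>x. x \<noteq> 0 \<longrightarrow> g x x > 0)"

definition is_jordan_levi_civita ::
    "('a::real_vector \<Rightarrow> 'a \<Rightarrow> 'a) \<Rightarrow> ('a \<Rightarrow> 'a \<Rightarrow> real) \<Rightarrow> ('a \<Rightarrow> 'a \<Rightarrow> 'a) \<Rightarrow> bool" where
  "is_jordan_levi_civita m g N \<longleftrightarrow> bilinear N \<and>
     (\<forall>x y. N x y + N y x = m x y) \<and>
     (\<forall>x y z. g (N x y) z = g y (N x z))"

definition jordan_levi_civita ::
    "('a::real_vector \<Rightarrow> 'a \<Rightarrow> 'a) \<Rightarrow> ('a \<Rightarrow> 'a \<Rightarrow> real) \<Rightarrow> 'a \<Rightarrow> 'a \<Rightarrow> 'a" where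
  "jordan_levi_civita m g = (THE N. is_jordan_levi_civita m g N)"

definition jordan_curvature ::
    "('a::real_vector \<Rightarrow> 'a \<Rightarrow> 'a) \<Rightarrow> ('a \<Rightarrow> 'a \<Rightarrow> real) \<Rightarrow> 'a \<Rightarrow> 'a \<Rightarrow> 'a \<Rightarrow> 'a" where
  "jordan_curvature m g x y z =
     (let N = jordan_levi_civita m g in - N x (N y z) - N y (N x z) + N (m x y) z)"

text \<open>
  The trace of an endomorphism of a finite-dimensional space, computed in an arbitrarily chosen
  basis; \<open>lin_trace_eq\<close> below shows that the choice is irrelevant.
\<close>

definition lin_trace :: "('a::real_vector \<Rightarrow> 'a) \<Rightarrow> real" where
  "lin_trace f =
     (let B = (SOME B. finite B \<and> independent B \<and> span B = UNIV)
      in \<Sum>b\<in>B. representation B (f b) b)"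

definition jordan_ric ::
    "('a::real_vector \<Rightarrow> 'a \<Rightarrow> 'a) \<Rightarrow> ('a \<Rightarrow> 'a \<Rightarrow> real) \<Rightarrow> 'a \<Rightarrow> 'a \<Rightarrow> real" where
  "jordan_ric m g u v = lin_trace (\<lambda>x. jordan_curvature m g u x v)"

definition jordan_Ric ::
    "('a::real_vector \<Rightarrow> 'a \<Rightarrow> 'a) \<Rightarrow> ('a \<Rightarrow> 'a \<Rightarrow> real) \<Rightarrow> 'a \<Rightarrow> 'a \<Rightarrow> real" where
  "jordan_Ric m g u v = (jordan_ric m g u v + jordan_ric m g v u) / 2"

definition jordan_einstein_metric ::
    "('a::real_vector \<Rightarrow> 'a \<Rightarrow> 'a) \<Rightarrow> ('a \<Rightarrow> 'a \<Rightarrow> real) \<Rightarrow> bool" where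
  "jordan_einstein_metric m g \<longleftrightarrow> inner_product g \<and>
     (\<exists>c. \<forall>u v. jordan_Ric m g u v = c * g u v)"

lemma trace_basis_independent:
  fixes f :: "'a::real_vector \<Rightarrow> 'a"
  assumes f: "linear f"
    and B: "finite B" "independent B" "span B = UNIV"
    and C: "finite C" "independent C" "span C = UNIV"
  shows "(\<Sum>b\<in>B. representation B (f b) b) = (\<Sum>c\<in>C. representation C (f c) c)"
proof -
  have lin: "linear (\<lambda>v. representation D v d)" if "independent D" "span D = UNIV" for D :: "'a set" and d
    using that by (auto intro!: linearI simp: real_vector.representation_add real_vector.representation_scale)
  have exp: "(\<Sum>d\<in>D. representation D v d *\<^sub>R d) = v"
    if "finite D" "independent D" "span D = UNIV" for D :: "'a set" and v
    using that by (intro real_vector.sum_representation_eq) auto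
  have 1: "representation B (f b) b = (\<Sum>c\<in>C. representation C (f b) c * representation B c b)" for b
  proof -
    have "representation B (f b) b = representation B (\<Sum>c\<in>C. representation C (f b) c *\<^sub>R c) b"
      by (simp add: exp[OF C])
    also have "\<dots> = (\<Sum>c\<in>C. representation C (f b) c * representation B c b)"
      by (simp add: linear_sum[OF lin[OF B(2,3)]] linear_cmul[OF lin[OF B(2,3)]])
    finally show ?thesis .
  qed
  have 2: "(\<Sum>b\<in>B. representation C (f b) c * representation B c b) = representation C (f c) c" for c
  proof -
    have l: "linear (\<lambda>v. representation C (f v) c)"
      using linear_compose[OF f lin[OF C(2,3), of c]] by (simp add: o_def)
    have "representation C (f c) c = representation C (f (\<Sum>b\<in>B. representation B c b *\<^sub>R b)) c"
      by (simp add: exp[OF B])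
    also have "\<dots> = (\<Sum>b\<in>B. representation C (f b) c * representation B c b)"
      by (simp add: linear_sum[OF l] linear_cmul[OF l] mult.commute)
    finally show ?thesis by simp
  qed
  have "(\<Sum>b\<in>B. representation B (f b) b)
      = (\<Sum>b\<in>B. \<Sum>c\<in>C. representation C (f b) c * representation B c b)"
    by (simp add: 1)
  also have "\<dots> = (\<Sum>c\<in>C. \<Sum>b\<in>B. representation C (f b) c * representation B c b)"
    by (rule sum.swap)
  finally show ?thesis by (simp add: 2)
qed

lemma lin_trace_eq:
  fixes f :: "'a::real_vector \<Rightarrow> 'a"
  assumes f: "linear f" and B: "finite B" "independent B" "span B = UNIV"
  shows "lin_trace f = (\<Sum>b\<in>B. representation B (f b) b)"
proof -
  let ?C = "SOME B :: 'a set. finite B \<and> independent B \<and> span B = UNIV"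
  have C: "finite ?C \<and> independent ?C \<and> span ?C = UNIV"
    by (rule someI[of _ B]) (use B in simp)
  show ?thesis
    unfolding lin_trace_def Let_def
    by (rule trace_basis_independent) (use C f B in auto)
qed

lemma riesz_on_span:
  fixes g :: "'a::real_vector \<Rightarrow> 'a \<Rightarrow> real"
  assumes g: "inner_product g" and B: "finite B" and p: "linear p"
  shows "\<exists>w\<in>span B. \<forall>y\<in>span B. g w y = p y"
  using B p
proof (induction B arbitrary: p rule: finite_induct)
  case empty
  then show ?case
    using g by (auto simp: inner_product_def bilinear_lzero linear_0)
next
  case (insert b B)
  have bg: "bilinear g" and pos: "\<And>x. x \<noteq> 0 \<Longrightarrow> g x x > 0" and sy: "\<And>x y. g x y = g y x"
    using g by (auto simp: inner_product_def)
  note bil = bilinear_ladd[OF bg] bilinear_radd[OF bg] bilinear_lsub[OF bg] bilinear_rsub[OF bg]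
    bilinear_lmul[OF bg] bilinear_rmul[OF bg]
  show ?case
  proof (cases "b \<in> span B")
    case True
    then show ?thesis using insert by (simp add: span_redundant)
  next
    case False
    obtain w where w: "w \<in> span B" "\<And>y. y \<in> span B \<Longrightarrow> g w y = p y"
      using insert by blast
    have "linear (g b)" using bg by (simp add: bilinear_def)
    then obtain q where q: "q \<in> span B" "\<And>y. y \<in> span B \<Longrightarrow> g q y = g b y"
      using insert.IH by blast
    define n where "n = b - q"
    have n0: "n \<noteq> 0" using False q(1) by (auto simp: n_def)
    have nB: "g n y = 0" "g y n = 0" if "y \<in> span B" for y
      using q(2)[OF that] sy[of y n] by (auto simp: n_def bil)
    have sub: "span B \<subseteq> span (insert b B)" by (rule span_mono) auto
    have nn: "n \<in> span (insert b B)"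
      unfolding n_def using q(1) sub by (intro span_diff) (auto intro: span_base)
    let ?w = "w + (p n / g n n) *\<^sub>R n"
    have "g ?w y = p y" if "y \<in> span (insert b B)" for y
    proof -
      obtain k where k: "y - k *\<^sub>R b \<in> span B" using \<open>y \<in> span (insert b B)\<close>
        by (auto simp: span_insert)
      define s where "s = (y - k *\<^sub>R b) + k *\<^sub>R q"
      have s: "s \<in> span B" unfolding s_def using k q(1) by (intro span_add span_scale)
      have y: "y = s + k *\<^sub>R n" by (simp add: s_def n_def algebra_simps)
      have "g ?w y = g w s + k * p n"
        using pos[OF n0] nB[OF s] nB[OF w(1)] by (simp add: y bil)
      then show ?thesis
        using w(2)[OF s] insert.prems by (simp add: y linear_add linear_cmul)
    qed
    moreover have "?w \<in> span (insert b B)"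
      using w(1) sub nn by (intro span_add span_scale) auto
    ultimately show ?thesis by blast
  qed
qed

lemma inner_product_ext:
  assumes g: "inner_product g" and "\<And>z. g x z = g y z"
  shows "x = y"
proof (rule ccontr)
  assume "x \<noteq> y"
  then have "g (x - y) (x - y) > 0" using g by (simp add: inner_product_def)
  moreover have "g (x - y) (x - y) = 0"
    using g assms(2)[of "x - y"] bilinear_lsub[of g x y "x - y"] unfolding inner_product_def by linarith
  ultimately show False by simp
qed

lemma is_jordan_levi_civita_koszul:
  assumes g: "inner_product g" and N: "is_jordan_levi_civita m g N"
  shows "g (N x y) z = (g (m x y) z - g (m y z) x + g (m z x) y) / 2"
proof -
  have bg: "bilinear g" and sy: "\<And>x y. g x y = g y x" using g by (auto simp: inner_product_def)
  have t: "N a b + N b a = m a b" and a: "g (N a b) c = g b (N a c)" for a b c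
    using N by (auto simp: is_jordan_levi_civita_def)
  have s: "g (m a b) c = g (N a b) c + g (N b a) c" for a b c
    by (simp add: t[symmetric] bilinear_ladd[OF bg])
  have r: "g (N a b) c = g (N a c) b" for a b c using a[of a b c] sy by simp
  show ?thesis
    using r[of x y z] r[of y x z] r[of z x y] by (simp add: s)
qed

lemma is_jordan_levi_civita_ex1:
  fixes m :: "'a::real_vector \<Rightarrow> 'a \<Rightarrow> 'a"
  assumes fd: "fin_dim TYPE('a)" and g: "inner_product g" and m: "bilinear m" "\<And>x y. m x y = m y x"
  shows "\<exists>!N. is_jordan_levi_civita m g N"
proof (rule ex_ex1I)
  have bg: "bilinear g" and sy: "\<And>x y. g x y = g y x" using g by (auto simp: inner_product_def)
  note bil = bilinear_ladd[OF bg] bilinear_radd[OF bg] bilinear_lmul[OF bg] bilinear_rmul[OF bg]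
     bilinear_ladd[OF m(1)] bilinear_radd[OF m(1)] bilinear_lmul[OF m(1)] bilinear_rmul[OF m(1)]
  let ?k = "\<lambda>x y z. (g (m x y) z - g (m y z) x + g (m z x) y) / 2"
  obtain B :: "'a set" where B: "finite B" "span B = UNIV" using fd by (auto simp: fin_dim_def)
  have "\<exists>w. \<forall>z. g w z = ?k x y z" for x y
    using riesz_on_span[OF g B(1), of "?k x y"]
    by (auto simp: B(2) bil linear_iff field_simps)
  then obtain N where N: "\<And>x y z. g (N x y) z = ?k x y z" by metis
  have "is_jordan_levi_civita m g N"
    unfolding is_jordan_levi_civita_def bilinear_def
  proof (intro conjI allI)
    show "linear (N x)" for x
      by (auto intro!: linearI inner_product_ext[OF g] simp: N bil field_simps)
    show "linear (\<lambda>x. N x y)" for y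
      by (auto intro!: linearI inner_product_ext[OF g] simp: N bil field_simps)
    show "N x y + N y x = m x y" for x y
    proof (rule inner_product_ext[OF g])
      fix z
      have c: "m y x = m x y" "m x z = m z x" "m z y = m y z" by (rule m(2))+
      show "g (N x y + N y x) z = g (m x y) z"
        by (simp only: bilinear_ladd[OF bg] N c) (simp add: field_simps)
    qed
    show "g (N x y) z = g y (N x z)" for x y z
    proof -
      have c: "m y x = m x y" "m x z = m z x" "m z y = m y z" by (rule m(2))+
      show ?thesis
        by (simp only: sy[of y "N x z"] N c) (simp add: field_simps)
    qed
  qed
  then show "\<exists>N. is_jordan_levi_civita m g N" by blast
next
  fix N N' assume "is_jordan_levi_civita m g N" "is_jordan_levi_civita m g N'"
  then show "N = N'"
    by (intro ext inner_product_ext[OF g]) (simp add: is_jordan_levi_civita_koszul[OF g])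
qed

end

theory Submission
  imports Defs "HOL-Computational_Algebra.Fundamental_Theorem_Algebra"
begin

text \<open>
  Let \<open>tr x\<close> be the trace of the multiplication \<open>L x\<close>, and \<open>n = tr e\<close> the dimension of the
  algebra \<open>A\<close>. The trace form \<open>g x y = tr (x y)\<close> is associative, because the operators
  \<open>[L a, L b]\<close> are derivations, and positive definite, because a formally real Jordan algebra
  satisfies the spectral theorem. In general \<open>g\<close> is not Einstein: its Ricci form also involves
  \<open>\<beta> x y = Tr (L x \<circ> L y)\<close>. The central point is that nevertheless
  \<open>\<beta> = \<alpha> g + \<gamma> tr \<otimes> tr\<close> for constants with \<open>\<alpha> \<ge> 0\<close> and \<open>\<alpha> + \<gamma> n = 1\<close> (lemma \<open>\<beta>_eq\<close>).

  This follows from Schur's lemma once the traceless part of \<open>A\<close> is known to have no proper nonzero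
  subspace \<open>E\<close> invariant under all \<open>[L a, L b]\<close> (\<open>traceless_irreducible\<close>). Let \<open>F\<close> be the
  orthogonal complement of such an \<open>E\<close> in the traceless part. A nonzero element of \<open>E\<close> has a
  spectral idempotent \<open>c\<close> whose Peirce half space lies in \<open>E\<close> (\<open>ex_idem_half_subset\<close>). Together
  with \<open>E \<inter> F = 0\<close> this makes every element of \<open>F\<close> operator-commute with all of \<open>A\<close>
  (\<open>deriv_one_zero\<close>), and in a simple algebra a central traceless element vanishes. So \<open>F = 0\<close>.

  Rescaling \<open>g\<close> along the unit, \<open>h s = g + s tr \<otimes> tr\<close>, one finds an explicit connection, and a Ricci
  form that is a combination of \<open>\<beta>\<close>, \<open>g\<close> and \<open>tr \<otimes> tr\<close>, hence of the last two. Being proportional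
  to \<open>h s\<close> is the equation \<open>(2 s + \<gamma>) (n s + 1) = 0\<close>. The root \<open>s = - 1 / n\<close> gives a degenerate
  form; the root \<open>s = - \<gamma> / 2\<close> gives \<open>1 + s n = (1 + \<alpha>) / 2 > 0\<close>, which is positive definiteness.
\<close>

section \<open>Polynomials in an endomorphism\<close>

text \<open>
  The value \<open>p(T) v\<close>. With \<open>T\<close> the multiplication by \<open>x\<close> and \<open>v\<close> the unit this is \<open>p(x)\<close>; with
  \<open>T\<close> selfadjoint it produces eigenvectors.
\<close>

definition peval :: "('a::real_vector \<Rightarrow> 'a) \<Rightarrow> 'a \<Rightarrow> real poly \<Rightarrow> 'a" where
  "peval T v p = fold_coeffs (\<lambda>a y. a *\<^sub>R v + T y) p 0"

lemma peval_0 [simp]: "peval T v 0 = 0"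
  by (simp add: peval_def)

lemma peval_pCons:
  assumes "linear T"
  shows "peval T v (pCons a p) = a *\<^sub>R v + T (peval T v p)"
  by (cases "a = 0 \<and> p = 0") (use linear_0[OF assms] in \<open>auto simp: peval_def\<close>)

lemma peval_add:
  assumes "linear T"
  shows "peval T v (p + q) = peval T v p + peval T v q"
  by (induction p q rule: poly_induct2)
     (simp_all add: peval_pCons[OF assms] linear_add[OF assms] algebra_simps)

lemma peval_smult:
  assumes "linear T"
  shows "peval T v (smult a p) = a *\<^sub>R peval T v p"
  by (induction p) (simp_all add: peval_pCons[OF assms] linear_cmul[OF assms] algebra_simps)

lemma peval_mult:
  assumes "linear T"
  shows "peval T v (p * q) = peval T (peval T v q) p"
  by (induction p)
     (simp_all add: peval_pCons[OF assms] peval_add[OF assms] peval_smult[OF assms])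

lemma peval_diff:
  assumes "linear T"
  shows "peval T v (p - q) = peval T v p - peval T v q"
  using peval_add[OF assms, of v "p - q" q] by simp

lemma peval_sum:
  assumes "linear T"
  shows "peval T v (\<Sum>i\<in>I. f i) = (\<Sum>i\<in>I. peval T v (f i))"
  by (induction I rule: infinite_finite_induct) (simp_all add: peval_add[OF assms])

lemma peval_monom:
  assumes "linear T"
  shows "peval T v (monom a i) = a *\<^sub>R (T ^^ i) v"
proof (induction i)
  case 0
  show ?case by (simp add: monom_0 peval_pCons[OF assms] linear_0[OF assms])
next
  case (Suc i)
  then show ?case by (simp add: monom_Suc peval_pCons[OF assms] linear_cmul[OF assms])
qed

lemma peval_in_subspace:
  assumes "linear T" "subspace W" "v \<in> W" "\<And>x. x \<in> W \<Longrightarrow> T x \<in> W"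
  shows "peval T v p \<in> W"
  by (induction p)
     (use assms in \<open>auto simp: peval_pCons[OF assms(1)] subspace_0 intro!: subspace_add subspace_scale\<close>)

text \<open>
  Among the vectors \<open>v, T v, \<dots>, T\<^sup>n v\<close>, with \<open>n\<close> the size of a spanning set, there is either a
  repetition or a linear dependence.
\<close>

lemma ex_annihilating_poly:
  fixes T :: "'a::real_vector \<Rightarrow> 'a"
  assumes fd: "fin_dim TYPE('a)" and T: "linear T"
  shows "\<exists>p. p \<noteq> 0 \<and> peval T v p = 0"
proof -
  obtain B :: "'a set" where B: "finite B" "span B = UNIV" using fd by (auto simp: fin_dim_def)
  let ?f = "\<lambda>i. (T ^^ i) v"
  show ?thesis
  proof (cases "inj_on ?f {..card B}")
    case False
    then obtain i j where ij: "i \<noteq> j" "?f i = ?f j" by (auto simp: inj_on_def)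
    have "peval T v (monom 1 i - monom 1 j) = 0"
      by (simp add: peval_diff[OF T] peval_monom[OF T] ij)
    moreover have "coeff (monom 1 i - monom 1 j :: real poly) i = 1" using ij(1) by simp
    then have "monom 1 i - monom 1 j \<noteq> (0 :: real poly)" by (metis coeff_0 zero_neq_one)
    ultimately show ?thesis by blast
  next
    case True
    let ?S = "?f ` {..card B}"
    have "card ?S = Suc (card B)" using card_image[OF True] by simp
    then have "dependent ?S"
      using independent_span_bound[of B ?S] B by auto
    then obtain u where u: "\<exists>w\<in>?S. u w \<noteq> 0" "(\<Sum>w\<in>?S. u w *\<^sub>R w) = 0"
      by (subst (asm) dependent_finite) auto
    define p where "p = (\<Sum>i\<le>card B. monom (u (?f i)) i)"
    have "peval T v p = (\<Sum>i\<le>card B. u (?f i) *\<^sub>R ?f i)"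
      by (simp add: p_def peval_sum[OF T] peval_monom[OF T])
    also have "\<dots> = 0" using u(2) by (simp add: sum.reindex[OF True])
    finally have "peval T v p = 0" .
    moreover obtain i where i: "i \<le> card B" "u (?f i) \<noteq> 0" using u(1) by auto
    have "coeff p i = u (?f i)" using i(1) by (simp add: p_def coeff_sum)
    then have "p \<noteq> 0" using i(2) by auto
    ultimately show ?thesis by blast
  qed
qed

lemma ex_minimal_annihilating_poly:
  fixes T :: "'a::real_vector \<Rightarrow> 'a"
  assumes fd: "fin_dim TYPE('a)" and T: "linear T"
  obtains p where "p \<noteq> 0" "peval T v p = 0"
    "\<And>q. q \<noteq> 0 \<Longrightarrow> peval T v q = 0 \<Longrightarrow> degree p \<le> degree q"
proof -
  have "\<exists>p. (p \<noteq> 0 \<and> peval T v p = 0) \<and> (\<forall>q. q \<noteq> 0 \<and> peval T v q = 0 \<longrightarrow> degree p \<le> degree q)"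
    using ex_annihilating_poly[OF assms, of v]
      ex_has_least_nat[of "\<lambda>p. p \<noteq> 0 \<and> peval T v p = 0" _ degree] by blast
  then show ?thesis using that by blast
qed

text \<open>
  A complex root \<open>a + b \<i>\<close> yields the linear factor \<open>t - a\<close> if \<open>b = 0\<close>, and the factor
  \<open>(t - a)\<^sup>2 + b\<^sup>2\<close> otherwise. Writing the quadratic as a sum of squares is what lets positivity of a
  form, or formal reality of an algebra, rule it out.
\<close>

lemma real_poly_factor:
  fixes p :: "real poly"
  assumes "degree p > 0"
  obtains a where "[:- a, 1:] dvd p"
  | a b where "b \<noteq> 0" "[:- a, 1:] * [:- a, 1:] + [:b * b:] dvd p"
proof -
  let ?P = "map_poly complex_of_real p"
  have deg: "degree ?P = degree p" by (rule degree_map_poly) simp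
  have "\<not> constant (poly ?P)" using assms deg by (simp add: constant_degree)
  then obtain z where z: "poly ?P z = 0" using fundamental_theorem_of_algebra by blast
  define a b where "a = Re z" and "b = Im z"
  show ?thesis
  proof (cases "b = 0")
    case True
    then have "z = complex_of_real a" by (simp add: a_def b_def complex_eq_iff)
    moreover have "poly ?P (complex_of_real a) = complex_of_real (poly p a)"
      by (induction p) (simp_all add: map_poly_pCons)
    ultimately have "poly p a = 0" using z by simp
    then show ?thesis using that(1) by (simp add: poly_eq_0_iff_dvd)
  next
    case False
    let ?k = "[:- a, 1:] * [:- a, 1:] + [:b * b:]"
    have k: "?k = [:a * a + b * b, - 2 * a, 1:]" by simp
    have kz: "poly (map_poly complex_of_real ?k) z = 0"
      unfolding k by (simp add: map_poly_pCons a_def b_def complex_eq_iff algebra_simps)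
    define r where "r = p mod ?k"
    have dr: "degree r < 2" unfolding r_def using degree_mod_less'[of ?k p] k by (cases "p mod ?k = 0") auto
    then obtain c d where r: "r = [:c, d:]"
    proof -
      have "r = [:coeff r 0, coeff r 1:]"
        using dr by (intro poly_eqI) (auto simp: coeff_pCons coeff_eq_0 split: nat.split)
      then show ?thesis using that by blast
    qed
    have pe: "p = ?k * (p div ?k) + r" unfolding r_def by (simp only: mult_div_mod_eq)
    have hom: "map_poly complex_of_real (x * y + w) =
      map_poly complex_of_real x * map_poly complex_of_real y + map_poly complex_of_real w" for x y w
      by (intro poly_eqI) (simp add: coeff_map_poly coeff_mult)
    have "poly (map_poly complex_of_real r) z = 0"
      using z kz by (subst (asm) pe) (simp only: hom poly_add poly_mult, simp)
    then have "d * b = 0" "c + d * a = 0"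
      by (auto simp: r map_poly_pCons a_def b_def complex_eq_iff mult.commute)
    then have "r = 0" using False by (simp add: r)
    then show ?thesis using that(2)[OF False] unfolding r_def by (simp add: mod_eq_0_iff_dvd)
  qed
qed

lemma prod_linear_dvd:
  fixes q :: "real poly"
  assumes "finite S" "\<And>a. a \<in> S \<Longrightarrow> poly q a = 0"
  shows "(\<Prod>a\<in>S. [:- a, 1:]) dvd q"
  using assms
proof (induction S arbitrary: q rule: finite_induct)
  case (insert a S)
  obtain r where r: "q = [:- a, 1:] * r" using insert.prems[of a] by (auto simp: poly_eq_0_iff_dvd dvd_def)
  have "poly r b = 0" if "b \<in> S" for b
    using insert.prems[of b] insert.hyps that by (auto simp: r)
  then have "(\<Prod>a\<in>S. [:- a, 1:]) dvd r" by (rule insert.IH)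
  then show ?case using insert.hyps by (simp add: r mult_dvd_mono del: mult_pCons_left)
qed simp

section \<open>Traces and inner products\<close>

lemma ex_finite_basis:
  assumes "fin_dim TYPE('a::real_vector)"
  obtains B :: "'a::real_vector set" where "finite B" "independent B" "span B = UNIV"
proof -
  obtain C :: "'a set" where C: "finite C" "span C = UNIV" using assms by (auto simp: fin_dim_def)
  obtain B where "B \<subseteq> C" "independent B" "C \<subseteq> span B"
    using maximal_independent_subset[of C] by blast
  then have "finite B" "independent B" "span B = UNIV"
    using C finite_subset span_minimal[of C "span B"] by auto
  then show ?thesis using that by blast
qed

lemma ex_finite_subspace_basis:
  assumes fd: "fin_dim TYPE('a::real_vector)" and W: "subspace (W :: 'a set)"
  obtains B where "finite B" "independent B" "span B = W"
proof -
  obtain C :: "'a set" where C: "finite C" "span C = UNIV" using fd by (auto simp: fin_dim_def)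
  obtain B where B: "B \<subseteq> W" "independent B" "W \<subseteq> span B"
    using maximal_independent_subset[of W] by blast
  then have "finite B" using independent_span_bound[of C B] C by auto
  moreover have "span B = W" using B W span_minimal by blast
  ultimately show ?thesis using that B by blast
qed

lemma lin_trace_add:
  assumes "fin_dim TYPE('a::real_vector)" "linear f" "linear (h :: 'a \<Rightarrow> 'a)"
  shows "lin_trace (\<lambda>x. f x + h x) = lin_trace f + lin_trace h"
proof -
  obtain B :: "'a set" where B: "finite B" "independent B" "span B = UNIV"
    using ex_finite_basis[OF assms(1)] .
  note lin_trace_eq[OF _ B]
  then show ?thesis
    using assms B by (simp add: linear_compose_add real_vector.representation_add sum.distrib)
qed

lemma lin_trace_scale:
  assumes "fin_dim TYPE('a::real_vector)" "linear (f :: 'a \<Rightarrow> 'a)"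
  shows "lin_trace (\<lambda>x. k *\<^sub>R f x) = k * lin_trace f"
proof -
  obtain B :: "'a set" where B: "finite B" "independent B" "span B = UNIV"
    using ex_finite_basis[OF assms(1)] .
  note lin_trace_eq[OF _ B]
  then show ?thesis
    using assms B by (simp add: linear_compose_scale_right real_vector.representation_scale sum_distrib_left)
qed

lemma lin_trace_diff:
  assumes "fin_dim TYPE('a::real_vector)" "linear f" "linear (h :: 'a \<Rightarrow> 'a)"
  shows "lin_trace (\<lambda>x. f x - h x) = lin_trace f - lin_trace h"
  using lin_trace_add[OF assms(1,2) linear_compose_scale_right[OF assms(3), of "-1"]]
    lin_trace_scale[OF assms(1,3), of "-1"] by simp

lemma lin_trace_cyclic:
  assumes fd: "fin_dim TYPE('a::real_vector)" and f: "linear f" and h: "linear (h :: 'a \<Rightarrow> 'a)"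
  shows "lin_trace (\<lambda>x. f (h x)) = lin_trace (\<lambda>x. h (f x))"
proof -
  obtain B :: "'a set" where B: "finite B" "independent B" "span B = UNIV"
    using ex_finite_basis[OF fd] .
  have rep: "representation B (F y) b = (\<Sum>c\<in>B. representation B y c * representation B (F c) b)"
    if F: "linear F" for F :: "'a \<Rightarrow> 'a" and y b
  proof -
    have l: "linear (\<lambda>v. representation B (F v) b)"
      using B F by (auto intro!: linearI simp: real_vector.representation_add
          real_vector.representation_scale linear_add linear_cmul)
    have "y = (\<Sum>c\<in>B. representation B y c *\<^sub>R c)"
      using B by (intro real_vector.sum_representation_eq[symmetric]) auto
    then have "representation B (F y) b
        = representation B (F (\<Sum>c\<in>B. representation B y c *\<^sub>R c)) b" by simp
    also have "\<dots> = (\<Sum>c\<in>B. representation B y c * representation B (F c) b)"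
      by (simp add: linear_sum[OF l] linear_cmul[OF l])
    finally show ?thesis .
  qed
  have "lin_trace (\<lambda>x. f (h x)) = (\<Sum>b\<in>B. \<Sum>c\<in>B. representation B (h b) c * representation B (f c) b)"
    using linear_compose[OF h f] by (simp add: lin_trace_eq[OF _ B] o_def rep[OF f, of "h _"])
  also have "\<dots> = (\<Sum>c\<in>B. \<Sum>b\<in>B. representation B (f c) b * representation B (h b) c)"
    by (subst sum.swap) (simp add: mult.commute)
  also have "\<dots> = lin_trace (\<lambda>x. h (f x))"
    using linear_compose[OF f h] by (simp add: lin_trace_eq[OF _ B] o_def rep[OF h, of "f _"])
  finally show ?thesis .
qed

lemma lin_trace_rank_one:
  assumes fd: "fin_dim TYPE('a::real_vector)" and t: "linear (t :: 'a \<Rightarrow> real)"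
  shows "lin_trace (\<lambda>x. t x *\<^sub>R v) = t v"
proof -
  obtain B :: "'a set" where B: "finite B" "independent B" "span B = UNIV"
    using ex_finite_basis[OF fd] .
  have l: "linear (\<lambda>x. t x *\<^sub>R v)"
    using t by (auto intro!: linearI simp: linear_add linear_cmul algebra_simps)
  have "v = (\<Sum>c\<in>B. representation B v c *\<^sub>R c)"
    using B by (intro real_vector.sum_representation_eq[symmetric]) auto
  then have "t v = t (\<Sum>c\<in>B. representation B v c *\<^sub>R c)" by simp
  also have "\<dots> = (\<Sum>c\<in>B. representation B v c * t c)"
    by (simp add: linear_sum[OF t] linear_cmul[OF t])
  finally have "t v = (\<Sum>c\<in>B. representation B v c * t c)" .
  then show ?thesis
    using B by (simp add: lin_trace_eq[OF l B] real_vector.representation_scale mult.commute)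
qed

text \<open>
  A basis of the image of a projection, extended to the whole space, shows that the trace of the
  projection is the dimension of its image.
\<close>

lemma lin_trace_projection:
  assumes fd: "fin_dim TYPE('a::real_vector)" and P: "linear (P :: 'a \<Rightarrow> 'a)" "\<And>x. P (P x) = P x"
  shows "lin_trace P \<ge> 0" and "P v \<noteq> 0 \<Longrightarrow> lin_trace P > 0"
proof -
  obtain C where C: "finite C" "independent C" "span C = range P"
    using ex_finite_subspace_basis[OF fd] linear_subspace_image[OF P(1) subspace_UNIV] by blast
  obtain B where B: "C \<subseteq> B" "independent B" "UNIV \<subseteq> span B"
    using maximal_independent_subset_extend[OF subset_UNIV C(2)] .
  obtain D :: "'a set" where D: "finite D" "span D = UNIV" using fd by (auto simp: fin_dim_def)
  have fB: "finite B" using independent_span_bound[of D B] D B by auto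
  have 1: "representation B (P b) b = 1" if "b \<in> C" for b
  proof -
    have "b \<in> range P" using that C(3) span_base[of b C] by simp
    then have "P b = b" by (auto simp: P(2))
    then show ?thesis using that B real_vector.representation_basis[of B b] by auto
  qed
  have 0: "representation B (P b) b = 0" if "b \<in> B - C" for b
  proof -
    have "P b \<in> span C" by (simp add: C(3))
    then have "representation B (P b) = representation C (P b)"
      using B by (intro real_vector.representation_extend) auto
    then show ?thesis using that real_vector.representation_ne_zero[of C "P b" b] by auto
  qed
  have "lin_trace P = (\<Sum>b\<in>B. representation B (P b) b)"
    using fB B by (intro lin_trace_eq[OF P(1)]) auto
  also have "\<dots> = (\<Sum>b\<in>C. representation B (P b) b)"
    using fB B 0 by (intro sum.mono_neutral_right) auto
  also have "\<dots> = card C" by (simp add: 1)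
  finally have t: "lin_trace P = card C" .
  show "lin_trace P \<ge> 0" by (simp add: t)
  show "lin_trace P > 0" if "P v \<noteq> 0"
  proof -
    have "C \<noteq> {}" using that C(3) by auto
    then show ?thesis using C(1) by (simp add: t card_gt_0_iff)
  qed
qed

lemma ex_orthogonal_projection:
  fixes g :: "'a::real_vector \<Rightarrow> 'a \<Rightarrow> real"
  assumes fd: "fin_dim TYPE('a)" and g: "inner_product g" and W: "subspace W"
  obtains p where "p \<in> W" "\<And>y. y \<in> W \<Longrightarrow> g (x - p) y = 0"
proof -
  obtain B where B: "finite B" "span B = W" using ex_finite_subspace_basis[OF fd W] by metis
  have bg: "bilinear g" using g by (simp add: inner_product_def)
  then have "linear (g x)" by (simp add: bilinear_def)
  from riesz_on_span[OF g B(1) this] obtain p where "p \<in> W" "\<And>y. y \<in> W \<Longrightarrow> g p y = g x y"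
    using B by auto
  then show ?thesis using that by (simp add: bilinear_lsub[OF bg])
qed

text \<open>
  Gram-Schmidt, one spanning vector at a time. It is carried out for an arbitrary form \<open>g\<close>, since
  the inner products of interest here come from the algebra and not from a type class.
\<close>

lemma ex_orthonormal_spanning_set:
  fixes g :: "'a::real_vector \<Rightarrow> 'a \<Rightarrow> real"
  assumes g: "inner_product g" and "finite A"
  shows "\<exists>B. finite B \<and> span B = span A \<and> (\<forall>x\<in>B. \<forall>y\<in>B. g x y = (if x = y then 1 else 0))"
  using assms(2)
proof (induction A rule: finite_induct)
  case empty
  then show ?case by (intro exI[of _ "{}"]) auto
next
  case (insert a A)
  have bg: "bilinear g" and pos: "\<And>x. x \<noteq> 0 \<Longrightarrow> g x x > 0" and sy: "\<And>x y. g x y = g y x"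
    using g by (auto simp: inner_product_def)
  obtain B where B: "finite B" "span B = span A"
    "\<And>x y. x \<in> B \<Longrightarrow> y \<in> B \<Longrightarrow> g x y = (if x = y then 1 else 0)"
    using insert.IH by metis
  show ?case
  proof (cases "a \<in> span A")
    case True
    then have "span (insert a A) = span B" by (simp add: span_redundant B)
    then show ?thesis using B by (intro exI[of _ B]) auto
  next
    case False
    have "linear (g a)" using bg by (simp add: bilinear_def)
    from riesz_on_span[OF g B(1) this] obtain p
      where p: "p \<in> span B" "\<And>y. y \<in> span B \<Longrightarrow> g p y = g a y" by blast
    define k where "k = 1 / sqrt (g (a - p) (a - p))"
    define b where "b = k *\<^sub>R (a - p)"
    have "a - p \<noteq> 0" using False p(1) B(2) by auto
    then have k: "k > 0" "k * k * g (a - p) (a - p) = 1"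
      using pos[of "a - p"] by (auto simp: k_def)
    have "g (a - p) y = 0" if "y \<in> span B" for y using p(2)[OF that] by (simp add: bilinear_lsub[OF bg])
    then have ob: "g b y = 0" "g y b = 0" if "y \<in> B" for y
      using span_base[OF that] sy[of y b] by (auto simp: b_def bilinear_lmul[OF bg])
    have bb: "g b b = 1" using k(2) by (simp add: b_def bilinear_lmul[OF bg] bilinear_rmul[OF bg])
    have "b \<in> span (insert a B)"
      unfolding b_def using p(1) span_mono[of B "insert a B"]
      by (intro span_scale span_diff) (auto intro: span_base)
    moreover have "a = (1 / k) *\<^sub>R b + p" using k(1) by (simp add: b_def)
    then have "a \<in> span (insert b B)"
      using p(1) span_mono[of B "insert b B"] by (auto intro!: span_add span_scale intro: span_base)
    ultimately have "span (insert b B) = span (insert a B)"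
      by (intro equalityI span_minimal) (auto intro: span_base)
    also have "\<dots> = span (insert a A)" by (simp add: span_insert B(2))
    finally have "span (insert b B) = span (insert a A)" .
    moreover have "b \<notin> B" using ob(1)[of b] bb by auto
    ultimately show ?thesis
      using B ob bb by (intro exI[of _ "insert b B"]) auto
  qed
qed

text \<open>In an orthonormal basis the trace of \<open>f\<^sup>2\<close> is \<open>\<Sum> \<bar>f b\<bar>\<^sup>2\<close>.\<close>

lemma lin_trace_square_selfadjoint:
  fixes g :: "'a::real_vector \<Rightarrow> 'a \<Rightarrow> real"
  assumes fd: "fin_dim TYPE('a)" and g: "inner_product g"
    and f: "linear f" "\<And>x y. g (f x) y = g x (f y)"
  shows "lin_trace (\<lambda>x. f (f x)) \<ge> 0"
proof -
  have bg: "bilinear g" and pos: "\<And>x. x \<noteq> 0 \<Longrightarrow> g x x > 0" and sy: "\<And>x y. g x y = g y x"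
    using g by (auto simp: inner_product_def)
  obtain A :: "'a set" where A: "finite A" "span A = UNIV" using fd by (auto simp: fin_dim_def)
  obtain B where B: "finite B" "span B = UNIV"
    "\<And>x y. x \<in> B \<Longrightarrow> y \<in> B \<Longrightarrow> g x y = (if x = y then 1 else 0)"
    using ex_orthonormal_spanning_set[OF g A(1)] A(2) by metis
  have lg: "linear (\<lambda>x. g x y)" for y using bg by (simp add: bilinear_def)
  have exp: "g (\<Sum>c\<in>B. u c *\<^sub>R c) b = u b" if "b \<in> B" for u b
  proof -
    have "g (\<Sum>c\<in>B. u c *\<^sub>R c) b = (\<Sum>c\<in>B. u c * (if c = b then 1 else 0))"
      using B(3) that by (simp add: linear_sum[OF lg] linear_cmul[OF lg])
    also have "\<dots> = u b" using B(1) that by (simp add: if_distrib cong: if_cong)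
    finally show ?thesis .
  qed
  have ind: "independent B"
    unfolding dependent_finite[OF B(1)]
  proof safe
    fix u b assume "(\<Sum>c\<in>B. u c *\<^sub>R c) = 0" "b \<in> B" "u b \<noteq> 0"
    then show False using exp[of b u] bilinear_lzero[OF bg, of b] by simp
  qed
  have rep: "representation B v b = g v b" if "b \<in> B" for v b
    using exp[OF that, of "representation B v"] real_vector.sum_representation_eq[OF ind, of v B] B
    by auto
  have "lin_trace (\<lambda>x. f (f x)) = (\<Sum>b\<in>B. representation B (f (f b)) b)"
    using linear_compose[OF f(1) f(1)] by (intro lin_trace_eq[OF _ B(1) ind B(2)]) (simp add: o_def)
  also have "\<dots> = (\<Sum>b\<in>B. g (f b) (f b))" by (simp add: rep f(2))
  also have "\<dots> \<ge> 0"
  proof (rule sum_nonneg)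
    show "g (f b) (f b) \<ge> 0" for b
      using pos[of "f b"] bilinear_lzero[OF bg] by (cases "f b = 0") (auto simp: less_imp_le)
  qed
  finally show ?thesis .
qed

text \<open>
  Let \<open>p = k r\<close> be the minimal polynomial of \<open>v\<close>, with \<open>k\<close> a factor as in \<open>real_poly_factor\<close>; then
  \<open>w = r(T) v\<close> is nonzero and \<open>k(T) w = 0\<close>. If \<open>k\<close> were quadratic, pairing with \<open>w\<close> would give
  \<open>\<bar>(T - a) w\<bar>\<^sup>2 + b\<^sup>2 \<bar>w\<bar>\<^sup>2 = 0\<close>. So \<open>k\<close> is linear and \<open>w\<close> is an eigenvector.
\<close>

lemma ex_eigenvector_selfadjoint:
  fixes g :: "'a::real_vector \<Rightarrow> 'a \<Rightarrow> real"
  assumes fd: "fin_dim TYPE('a)" and g: "inner_product g"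
    and T: "linear T" "\<And>x y. g (T x) y = g x (T y)"
    and W: "subspace W" "\<And>x. x \<in> W \<Longrightarrow> T x \<in> W" "v \<in> W" "v \<noteq> 0"
  obtains w a where "w \<in> W" "w \<noteq> 0" "T w = a *\<^sub>R w"
proof -
  have bg: "bilinear g" and pos: "\<And>x. x \<noteq> 0 \<Longrightarrow> g x x > 0" and sy: "\<And>x y. g x y = g y x"
    using g by (auto simp: inner_product_def)
  note pe = peval_pCons[OF T(1)] peval_mult[OF T(1)] peval_add[OF T(1)]
  obtain p where p: "p \<noteq> 0" "peval T v p = 0"
    "\<And>q. q \<noteq> 0 \<Longrightarrow> peval T v q = 0 \<Longrightarrow> degree p \<le> degree q"
    using ex_minimal_annihilating_poly[OF fd T(1)] by metis
  have "degree p > 0"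
  proof (rule ccontr)
    assume "\<not> degree p > 0"
    then obtain c where "p = [:c:]" by (metis degree_eq_zeroE gr0I)
    then show False using p(1,2) W(4) by (simp add: pe linear_0[OF T(1)])
  qed
  have inW: "peval T v q \<in> W" for q by (rule peval_in_subspace) (use T W in auto)
  have ne: "peval T v r \<noteq> 0" if "p = k * r" "degree k > 0" for k r
  proof
    assume "peval T v r = 0"
    moreover have "r \<noteq> 0" "k \<noteq> 0" using that p(1) by auto
    ultimately have "degree p \<le> degree r" using p(3) by blast
    then show False using that \<open>r \<noteq> 0\<close> \<open>k \<noteq> 0\<close> by (simp add: degree_mult_eq)
  qed
  from \<open>degree p > 0\<close> show ?thesis
  proof (cases rule: real_poly_factor)
    case (1 a)
    then obtain r where r: "p = [:- a, 1:] * r" by (auto simp: dvd_def)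
    have "peval T (peval T v r) [:- a, 1:] = 0" using p(2) unfolding r pe(2) .
    then have "T (peval T v r) = a *\<^sub>R peval T v r" by (simp add: pe linear_0[OF T(1)])
    then show ?thesis using that[OF inW] ne[OF r] by simp
  next
    case (2 a b)
    then obtain r where r: "p = ([:- a, 1:] * [:- a, 1:] + [:b * b:]) * r" unfolding dvd_def by blast
    define w where "w = peval T v r"
    define y where "y = T w - a *\<^sub>R w"
    have "peval T w ([:- a, 1:] * [:- a, 1:] + [:b * b:]) = 0"
      using p(2) unfolding r pe(2)[of v "_ + _"] w_def .
    moreover have "peval T u [:- a, 1:] = T u - a *\<^sub>R u" for u
      by (simp add: pe linear_0[OF T(1)])
    moreover have "peval T w [:b * b:] = (b * b) *\<^sub>R w" by (simp add: pe linear_0[OF T(1)])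
    ultimately have "T y - a *\<^sub>R y + (b * b) *\<^sub>R w = 0"
      by (simp only: pe(2,3) y_def)
    then have "g (T y - a *\<^sub>R y + (b * b) *\<^sub>R w) w = 0" by (simp add: bilinear_lzero[OF bg])
    then have "g y y + b * b * g w w = 0"
      by (simp add: bilinear_ladd[OF bg] bilinear_lsub[OF bg] bilinear_lmul[OF bg] T(2) y_def
          bilinear_rsub[OF bg] bilinear_rmul[OF bg])
    moreover have "w \<noteq> 0" using ne[OF r] by (simp add: w_def)
    then have "b * b * g w w > 0" using 2(1) pos not_real_square_gt_zero[of b] mult_pos_pos[of "b * b" "g w w"]
      by blast
    moreover have "g y y \<ge> 0"
      using pos[of y] bilinear_lzero[OF bg] by (cases "y = 0") (auto simp: less_imp_le)
    ultimately show ?thesis by linarith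
  qed
qed

section \<open>Identities in a unital Jordan algebra\<close>

locale unital_jordan =
  fixes m :: "'a::real_vector \<Rightarrow> 'a \<Rightarrow> 'a" (infixl "\<odot>" 70) and e :: 'a
  assumes fin_dim: "fin_dim TYPE('a)"
    and jordan: "jordan_algebra m"
    and unit [simp]: "e \<odot> x = x"
begin

lemma bilinear_m: "bilinear m"
  using jordan by (simp add: jordan_algebra_def)

lemma comm: "x \<odot> y = y \<odot> x"
  using jordan by (simp add: jordan_algebra_def)

lemma unit_right [simp]: "x \<odot> e = x"
  by (simp add: comm[of x e])

lemma linear_m: "linear (m x)"
  using bilinear_m by (simp add: bilinear_def)

lemmas distribs = bilinear_ladd[OF bilinear_m] bilinear_radd[OF bilinear_m]
  bilinear_lsub[OF bilinear_m] bilinear_rsub[OF bilinear_m]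
  bilinear_lmul[OF bilinear_m] bilinear_rmul[OF bilinear_m]
  bilinear_lneg[OF bilinear_m] bilinear_rneg[OF bilinear_m]

lemmas zeros [simp] = bilinear_lzero[OF bilinear_m] bilinear_rzero[OF bilinear_m]

lemmas linear_intros = linear_m linear_compose[OF linear_m linear_m, unfolded o_def]
  linear_compose[OF linear_m linear_compose[OF linear_m linear_m], unfolded o_def]
  linear_compose_add linear_compose_sub linear_compose_scale_right

lemma jordan_identity: "x \<odot> ((x \<odot> x) \<odot> y) = (x \<odot> x) \<odot> (x \<odot> y)"
  using jordan unfolding jordan_algebra_def by blast

text \<open>
  Polarisation: the Jordan identity says that the trilinear expression
  \<open>a (bc \<cdot> y) - bc (ay)\<close>, which is symmetric in \<open>b\<close> and \<open>c\<close>, vanishes on the diagonal,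
  so its symmetrisation vanishes.
\<close>

lemma linearized_jordan:
  "a \<odot> ((b \<odot> c) \<odot> y) + b \<odot> ((c \<odot> a) \<odot> y) + c \<odot> ((a \<odot> b) \<odot> y)
    = (b \<odot> c) \<odot> (a \<odot> y) + (c \<odot> a) \<odot> (b \<odot> y) + (a \<odot> b) \<odot> (c \<odot> y)"
proof -
  define T where "T a b c = a \<odot> ((b \<odot> c) \<odot> y) - (b \<odot> c) \<odot> (a \<odot> y)" for a b c
  have add: "T (a + a') b c = T a b c + T a' b c" "T a (b + b') c = T a b c + T a b' c"
    "T a b (c + c') = T a b c + T a b c'" for a a' b b' c c'
    by (simp_all add: T_def distribs algebra_simps)
  have sym: "T a b c = T a c b" for a b c by (simp add: T_def comm[of b c])
  have diag: "T x x x = 0" for x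
    by (simp add: T_def jordan_identity)
  have two: "T a b b + 2 *\<^sub>R T b a b = - (T b a a + 2 *\<^sub>R T a a b)" for a b
  proof -
    have "T (a + b) (a + b) (a + b)
        = T a a a + T b b b + (T a b b + 2 *\<^sub>R T b a b + (T b a a + 2 *\<^sub>R T a a b))"
      by (simp add: add sym[of _ b a] scaleR_2 ac_simps)
    then have "T a b b + 2 *\<^sub>R T b a b + (T b a a + 2 *\<^sub>R T a a b) = 0"
      by (simp add: diag)
    then show ?thesis by (simp only: eq_neg_iff_add_eq_0)
  qed
  have neg: "T (- a) b c = - T a b c" "T a (- b) c = - T a b c" "T a b (- c) = - T a b c" for a b c
    by (simp_all add: T_def distribs)
  \<comment> \<open>The cubic form has a part linear in \<open>a\<close>, isolated by changing the sign of \<open>b\<close>.\<close>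
  have quad: "T a b b + 2 *\<^sub>R T b a b = 0" for a b
  proof -
    have "T a b b + 2 *\<^sub>R T b a b = - (T b a a + 2 *\<^sub>R T a a b)" by (rule two)
    moreover have "T a b b + 2 *\<^sub>R T b a b = T b a a + 2 *\<^sub>R T a a b"
      using two[of a "- b"] by (simp add: neg)
    ultimately have "2 *\<^sub>R (T a b b + 2 *\<^sub>R T b a b) = 0" by (metis add.left_inverse scaleR_2)
    then show ?thesis by simp
  qed
  have "2 *\<^sub>R (T a b c + T b c a + T c a b) = (T a (b + c) (b + c) + 2 *\<^sub>R T (b + c) a (b + c))
      - (T a b b + 2 *\<^sub>R T b a b) - (T a c c + 2 *\<^sub>R T c a c)"
    by (simp add: add sym[of _ c b] sym[of _ c a] sym[of _ b a] scaleR_2 algebra_simps)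
  then have "2 *\<^sub>R (T a b c + T b c a + T c a b) = 0" by (simp only: quad diff_self)
  then have "T a b c + T b c a + T c a b = 0" by simp
  then show ?thesis by (simp add: T_def algebra_simps)
qed

text \<open>
  The right-hand side of the linearised identity is symmetric in all four arguments; exchanging
  \<open>c\<close> and \<open>y\<close> on the left expresses multiplication by a threefold product through
  multiplications by its factors and their pairwise products.
\<close>

lemma triple_product_operator:
  "((a \<odot> b) \<odot> c) \<odot> y = (b \<odot> c) \<odot> (a \<odot> y) + (c \<odot> a) \<odot> (b \<odot> y) + (a \<odot> b) \<odot> (c \<odot> y)
    - a \<odot> (c \<odot> (b \<odot> y)) - b \<odot> (c \<odot> (a \<odot> y))"
proof -
  have "a \<odot> ((b \<odot> y) \<odot> c) + b \<odot> ((y \<odot> a) \<odot> c) + y \<odot> ((a \<odot> b) \<odot> c)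
    = (b \<odot> y) \<odot> (a \<odot> c) + (y \<odot> a) \<odot> (b \<odot> c) + (a \<odot> b) \<odot> (y \<odot> c)"
    by (rule linearized_jordan)
  then show ?thesis
    by (simp add: comm[of "b \<odot> y"] comm[of y] comm[of a c] comm[of "a \<odot> y" c] comm[of "a \<odot> y" "b \<odot> c"] algebra_simps)
qed

text \<open>
  The commutator \<open>[L a, L b]\<close>, named for being a derivation: this comes from subtracting two
  instances of the formula for threefold products.
\<close>

definition inner_deriv :: "'a \<Rightarrow> 'a \<Rightarrow> 'a \<Rightarrow> 'a" where
  "inner_deriv a b x = a \<odot> (b \<odot> x) - b \<odot> (a \<odot> x)"

lemma linear_deriv: "linear (inner_deriv a b)"
  unfolding inner_deriv_def by (intro linear_intros)

lemma deriv_product: "inner_deriv a b (x \<odot> y) = inner_deriv a b x \<odot> y + x \<odot> inner_deriv a b y"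
proof -
  have "((b \<odot> x) \<odot> a) \<odot> y - ((a \<odot> x) \<odot> b) \<odot> y = inner_deriv a b (x \<odot> y) - x \<odot> inner_deriv a b y"
    unfolding triple_product_operator[of b x a y] triple_product_operator[of a x b y] inner_deriv_def
    by (simp add: distribs comm[of x a] comm[of x b] comm[of b a])
  then show ?thesis
    by (simp add: inner_deriv_def distribs comm[of a "b \<odot> x"] comm[of b "a \<odot> x"] algebra_simps)
qed

text \<open>
  By the formula for threefold products, the multiplications by all powers of \<open>x\<close> are polynomials
  in the multiplications by \<open>x\<close> and \<open>x\<^sup>2\<close>, and these two commute by the Jordan identity.
\<close>

lemma power_commutes:
  fixes x :: 'a
  defines "pw \<equiv> \<lambda>n. (m x ^^ n) e"
  shows "x \<odot> (pw n \<odot> y) = pw n \<odot> (x \<odot> y) \<and> (x \<odot> x) \<odot> (pw n \<odot> y) = pw n \<odot> ((x \<odot> x) \<odot> y)"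
proof (induction n arbitrary: y rule: induct_nat_012)
  case (ge2 n)
  have pS: "pw (Suc k) = x \<odot> pw k" for k by (simp add: pw_def)
  have c: "x \<odot> ((x \<odot> x) \<odot> y) = (x \<odot> x) \<odot> (x \<odot> y)" for y
    by (rule jordan_identity)
  have *: "pw (Suc (Suc n)) \<odot> y = (x \<odot> x) \<odot> (pw n \<odot> y) + pw (Suc n) \<odot> (x \<odot> y) + pw (Suc n) \<odot> (x \<odot> y)
      - pw n \<odot> (x \<odot> (x \<odot> y)) - x \<odot> (x \<odot> (pw n \<odot> y))" for y
  proof -
    have "pw (Suc (Suc n)) \<odot> y = ((pw n \<odot> x) \<odot> x) \<odot> y" by (simp add: pS comm)
    then show ?thesis
      unfolding triple_product_operator[of "pw n" x x y] by (simp only: pS comm[of "pw n" x])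
  qed
  note i1 = ge2(1)[THEN conjunct1] note i2 = ge2(1)[THEN conjunct2]
  note j1 = ge2(2)[THEN conjunct1] note j2 = ge2(2)[THEN conjunct2]
  show ?case unfolding *
    by (simp only: distribs i1 i2 j1 j2 c)
qed (simp_all add: pw_def jordan_identity)

text \<open>Power associativity, in the form that evaluation of polynomials at \<open>x\<close> is multiplicative.\<close>

lemma peval_m_mult: "peval (m x) e (p * q) = peval (m x) e p \<odot> peval (m x) e q"
proof (induction p)
  case (pCons a p)
  have "x \<odot> (peval (m x) e p \<odot> y) = peval (m x) e p \<odot> (x \<odot> y)" for p y
  proof -
    have l: "linear (\<lambda>w. w \<odot> z)" for z using bilinear_m by (simp add: bilinear_def)
    have "peval (m x) e p = (\<Sum>i\<le>degree p. coeff p i *\<^sub>R (m x ^^ i) e)"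
      by (subst poly_as_sum_of_monoms[symmetric]) (simp only: peval_sum[OF linear_m] peval_monom[OF linear_m])
    then show ?thesis
      by (simp add: linear_sum[OF linear_m] linear_sum[OF l] distribs power_commutes[of x, THEN conjunct1])
  qed
  from this[of q "peval (m x) e p"]
  have "x \<odot> (peval (m x) e p \<odot> peval (m x) e q) = (x \<odot> peval (m x) e p) \<odot> peval (m x) e q"
    by (simp only: comm[of "peval (m x) e p" "peval (m x) e q"] comm[of "x \<odot> peval (m x) e p"])
  then show ?case
    using pCons.IH
    by (simp add: peval_pCons[OF linear_m] peval_add[OF linear_m] peval_smult[OF linear_m] distribs)
qed simp

section \<open>The trace form\<close>

definition tr :: "'a \<Rightarrow> real" where "tr x = lin_trace (m x)"

definition g :: "'a \<Rightarrow> 'a \<Rightarrow> real" where "g x y = tr (x \<odot> y)"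

definition \<beta> :: "'a \<Rightarrow> 'a \<Rightarrow> real" where "\<beta> x y = lin_trace (\<lambda>z. x \<odot> (y \<odot> z))"

lemmas trace_simps = lin_trace_add[OF fin_dim] lin_trace_diff[OF fin_dim] lin_trace_scale[OF fin_dim]

lemma linear_tr: "linear tr"
proof (rule linearI)
  show "tr (x + y) = tr x + tr y" for x y
    using lin_trace_add[OF fin_dim linear_m[of x] linear_m[of y]]
    by (simp add: tr_def flip: distribs(1))
  show "tr (k *\<^sub>R x) = k *\<^sub>R tr x" for k x
    using lin_trace_scale[OF fin_dim linear_m[of x], of k]
    by (simp add: tr_def flip: distribs(5))
qed

lemma g_sym: "g x y = g y x"
  by (simp add: g_def comm[of x y])

lemma bilinear_g: "bilinear g"
  unfolding bilinear_def g_def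
  by (auto intro!: linearI simp: distribs linear_add[OF linear_tr] linear_cmul[OF linear_tr])

lemmas g_distribs = bilinear_ladd[OF bilinear_g] bilinear_radd[OF bilinear_g]
  bilinear_lsub[OF bilinear_g] bilinear_rsub[OF bilinear_g]
  bilinear_lmul[OF bilinear_g] bilinear_rmul[OF bilinear_g]
  bilinear_lneg[OF bilinear_g] bilinear_rneg[OF bilinear_g]

lemmas g_zeros [simp] = bilinear_lzero[OF bilinear_g] bilinear_rzero[OF bilinear_g]

lemma g_unit [simp]: "g e x = tr x" "g x e = tr x"
  by (simp_all add: g_def)

text \<open>Multiplication by a value of a derivation is a commutator of operators, hence traceless.\<close>

lemma tr_deriv: "tr (inner_deriv a b c) = 0"
proof -
  have "inner_deriv a b c \<odot> y = inner_deriv a b (c \<odot> y) - c \<odot> inner_deriv a b y" for y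
    by (simp add: deriv_product)
  then have "m (inner_deriv a b c) = (\<lambda>y. inner_deriv a b (c \<odot> y) - c \<odot> inner_deriv a b y)" by (rule ext)
  then have "tr (inner_deriv a b c) = lin_trace (\<lambda>y. inner_deriv a b (c \<odot> y) - c \<odot> inner_deriv a b y)"
    by (simp add: tr_def)
  also have "\<dots> = 0"
    using linear_compose[OF linear_m linear_deriv] linear_compose[OF linear_deriv linear_m]
      lin_trace_cyclic[OF fin_dim linear_deriv[of a b] linear_m[of c]]
    by (simp add: trace_simps o_def)
  finally show ?thesis .
qed

lemma g_assoc: "g (x \<odot> y) z = g y (x \<odot> z)"
proof -
  have "tr (inner_deriv z y x) = g (x \<odot> y) z - g y (x \<odot> z)"
    by (simp add: inner_deriv_def g_def linear_diff[OF linear_tr] comm)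
  then show ?thesis by (simp add: tr_deriv)
qed

lemma g_deriv: "g (inner_deriv a b x) y = - g x (inner_deriv a b y)"
  by (simp add: inner_deriv_def g_distribs g_assoc)

text \<open>Both sides equal \<open>g (b x) (a y) - g (a x) (b y)\<close>: the pair symmetry of a curvature tensor.\<close>

lemma g_deriv_pair_symmetry: "g (inner_deriv a b x) y = g (inner_deriv x y a) b"
proof -
  have 1: "g (p \<odot> (q \<odot> r)) z = g (q \<odot> r) (p \<odot> z)" for p q r z by (rule g_assoc)
  show ?thesis
    unfolding inner_deriv_def g_distribs 1
    by (simp add: comm[of x b] comm[of x a] comm[of y a] comm[of y b] g_sym)
qed

lemma \<beta>_sym: "\<beta> x y = \<beta> y x"
  unfolding \<beta>_def by (rule lin_trace_cyclic[OF fin_dim linear_m linear_m])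

lemma linear_\<beta>: "linear (\<beta> x)"
proof (rule linearI)
  show "\<beta> x (y + z) = \<beta> x y + \<beta> x z" for y z
    by (simp add: \<beta>_def distribs trace_simps linear_intros)
  show "\<beta> x (k *\<^sub>R y) = k *\<^sub>R \<beta> x y" for k y
    by (simp add: \<beta>_def distribs trace_simps linear_intros)
qed

lemma \<beta>_unit [simp]: "\<beta> e x = tr x"
  by (simp add: \<beta>_def tr_def)

lemma \<beta>_deriv: "\<beta> (inner_deriv a b x) y = - \<beta> x (inner_deriv a b y)"
proof -
  have l: "linear (\<lambda>z. inner_deriv a b x \<odot> (y \<odot> z))" "linear (\<lambda>z. x \<odot> (inner_deriv a b y \<odot> z))"
    "linear (\<lambda>z. x \<odot> (y \<odot> z))"
    by (intro linear_intros)+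
  have l': "linear (\<lambda>z. inner_deriv a b (x \<odot> (y \<odot> z)))" "linear (\<lambda>z. x \<odot> (y \<odot> inner_deriv a b z))"
    using linear_compose[OF l(3) linear_deriv] linear_compose[OF linear_deriv l(3)] by (simp_all add: o_def)
  have "\<beta> (inner_deriv a b x) y + \<beta> x (inner_deriv a b y)
      = lin_trace (\<lambda>z. inner_deriv a b x \<odot> (y \<odot> z) + x \<odot> (inner_deriv a b y \<odot> z))"
    by (simp add: \<beta>_def trace_simps l)
  also have "\<dots> = lin_trace (\<lambda>z. inner_deriv a b (x \<odot> (y \<odot> z)) - x \<odot> (y \<odot> inner_deriv a b z))"
    by (simp add: deriv_product distribs)
  also have "\<dots> = 0"
    using lin_trace_cyclic[OF fin_dim linear_deriv l(3), of a b] by (simp add: trace_simps l')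
  finally show ?thesis by simp
qed

section \<open>Peirce decomposition\<close>

definition idem :: "'a \<Rightarrow> bool" where "idem c \<longleftrightarrow> c \<odot> c = c"

definition peirce :: "'a \<Rightarrow> real \<Rightarrow> 'a set" where "peirce c k = {x. c \<odot> x = k *\<^sub>R x}"

lemma subspace_peirce: "subspace (peirce c k)"
  by (auto simp: subspace_def peirce_def distribs algebra_simps)

lemma idem_complement: "idem c \<Longrightarrow> idem (e - c)"
  by (simp add: idem_def distribs)

lemma peirce_complement: "peirce (e - c) k = peirce c (1 - k)"
  by (auto simp: peirce_def distribs algebra_simps)

text \<open>The cubic \<open>2 t\<^sup>3 - 3 t\<^sup>2 + t\<close> satisfied by \<open>L c\<close> has the roots \<open>0\<close>, \<open>1/2\<close> and \<open>1\<close>.\<close>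

lemma idem_cubic:
  assumes "idem c"
  shows "2 *\<^sub>R (c \<odot> (c \<odot> (c \<odot> y))) = 3 *\<^sub>R (c \<odot> (c \<odot> y)) - c \<odot> y"
proof -
  have c: "c \<odot> c = c" using assms by (simp add: idem_def)
  have "c \<odot> y = 3 *\<^sub>R (c \<odot> (c \<odot> y)) - 2 *\<^sub>R (c \<odot> (c \<odot> (c \<odot> y)))"
    using triple_product_operator[of c c c y]
    by (simp add: c scaleR_2 scaleR_add_left[of 2 1, simplified] algebra_simps)
  then show ?thesis by (simp add: algebra_simps)
qed

text \<open>Interpolation polynomials in \<open>L c\<close>: the projections to the Peirce spaces for \<open>1\<close> and \<open>1/2\<close>.\<close>

definition proj_one :: "'a \<Rightarrow> 'a \<Rightarrow> 'a" where
  "proj_one c x = 2 *\<^sub>R (c \<odot> (c \<odot> x)) - c \<odot> x"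

definition proj_half :: "'a \<Rightarrow> 'a \<Rightarrow> 'a" where
  "proj_half c x = 4 *\<^sub>R (c \<odot> x - c \<odot> (c \<odot> x))"

lemma proj_one_in:
  assumes c: "idem c"
  shows "proj_one c x \<in> peirce c 1"
  using idem_cubic[OF c, of x]
  by (simp add: proj_one_def peirce_def distribs scaleR_2 scaleR_add_left[of 2 1, simplified])

lemma proj_half_in:
  assumes c: "idem c"
  shows "proj_half c x \<in> peirce c (1/2)"
proof -
  let ?y = "c \<odot> x" and ?z = "c \<odot> (c \<odot> x)" and ?w = "c \<odot> (c \<odot> (c \<odot> x))"
  have "2 *\<^sub>R (?z - ?w) = ?y - ?z"
    using idem_cubic[OF c, of x]
    by (simp add: scaleR_2 scaleR_add_left[of 2 1, simplified] algebra_simps)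
  then have "2 *\<^sub>R (2 *\<^sub>R (?z - ?w)) = 2 *\<^sub>R (?y - ?z)" by (rule arg_cong)
  then show ?thesis by (simp add: proj_half_def peirce_def distribs)
qed

lemma peirce_decomposition:
  assumes c: "idem c"
  obtains x1 xh x0 where "x = x1 + xh + x0" "x1 \<in> peirce c 1" "xh \<in> peirce c (1/2)" "x0 \<in> peirce c 0"
proof -
  have four: "4 *\<^sub>R y = 3 *\<^sub>R y + y" for y :: 'a by (simp add: scaleR_add_left[of 3 1, simplified])
  have "c \<odot> (x - proj_one c x - proj_half c x) = 0"
    using idem_cubic[OF c, of x]
    by (simp add: proj_one_def proj_half_def distribs four scaleR_2 scaleR_add_left[of 2 1, simplified] algebra_simps)
  then show ?thesis
    by (intro that[of "proj_one c x" "proj_half c x" "x - proj_one c x - proj_half c x"])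
       (simp_all add: proj_one_in proj_half_in c, simp add: peirce_def)
qed

text \<open>\<open>L c\<close> is a projection plus half a projection, and \<open>c\<close> lies in the image of the first.\<close>

lemma tr_idem_pos:
  assumes c: "idem c" and "c \<noteq> 0"
  shows "tr c > 0"
proof -
  have l: "linear (proj_one c)" "linear (proj_half c)"
    unfolding proj_one_def proj_half_def by (intro linear_intros)+
  have "proj_one c (proj_one c x) = proj_one c x" for x
    using proj_one_in[OF c, of x] unfolding peirce_def
    by (subst proj_one_def) (simp add: scaleR_2)
  moreover have "proj_half c (proj_half c x) = proj_half c x" for x
    using proj_half_in[OF c, of x] unfolding peirce_def
    by (subst proj_half_def) (simp add: distribs scaleR_diff_right flip: scaleR_diff_left)
  moreover have "proj_one c c = c" using c by (simp add: proj_one_def idem_def scaleR_2)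
  ultimately have "lin_trace (proj_one c) > 0" "lin_trace (proj_half c) \<ge> 0"
    using lin_trace_projection[OF fin_dim l(1)] lin_trace_projection(1)[OF fin_dim l(2)] assms(2) by metis+
  moreover have "m c = (\<lambda>x. proj_one c x + (1/2) *\<^sub>R proj_half c x)"
    by (simp add: fun_eq_iff proj_one_def proj_half_def algebra_simps scaleR_2)
  then have "tr c = lin_trace (proj_one c) + lin_trace (proj_half c) / 2"
    by (simp add: tr_def trace_simps l linear_intros)
  ultimately show ?thesis by linarith
qed

lemma peirce_commute:
  assumes "idem c" "a \<in> peirce c k" "k = 0 \<or> k = 1"
  shows "c \<odot> (a \<odot> x) = a \<odot> (c \<odot> x)"
proof -
  have ca: "c \<odot> a = k *\<^sub>R a" "a \<odot> c = k *\<^sub>R a" "c \<odot> c = c"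
    using assms(1,2) by (auto simp: idem_def peirce_def comm[of a c])
  show ?thesis
    using linearized_jordan[of c c a x] assms(3) by (auto simp: ca distribs)
qed

lemma peirce_mult:
  assumes "idem c" "a \<in> peirce c k" "k = 0 \<or> k = 1" "x \<in> peirce c l"
  shows "a \<odot> x \<in> peirce c l"
  using peirce_commute[OF assms(1-3), of x] assms(4) by (simp add: peirce_def distribs)

lemma peirce_1_0:
  assumes "idem c" "a \<in> peirce c 1" "b \<in> peirce c 0"
  shows "a \<odot> b = 0"
proof -
  have "a \<odot> b \<in> peirce c 0" "b \<odot> a \<in> peirce c 1"
    using peirce_mult assms by blast+
  then show ?thesis by (simp add: peirce_def comm[of b a])
qed

text \<open>
  Twice the multiplication by \<open>A_1 = peirce c 1\<close> on the half space is a homomorphism of Jordan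
  algebras into the operators with the symmetrised product. The identity is the linearised Jordan
  identity evaluated at \<open>c\<close>.
\<close>

lemma peirce_half_module:
  assumes "idem c" "a \<in> peirce c 1" "b \<in> peirce c 1" "u \<in> peirce c (1/2)"
  shows "(a \<odot> b) \<odot> u = a \<odot> (b \<odot> u) + b \<odot> (a \<odot> u)"
proof -
  have "a \<odot> b \<in> peirce c 1" "a \<odot> u \<in> peirce c (1/2)" "b \<odot> u \<in> peirce c (1/2)"
    using peirce_mult assms by blast+
  then have *: "a \<odot> c = a" "b \<odot> c = b" "u \<odot> c = (1/2) *\<^sub>R u" "(a \<odot> b) \<odot> c = a \<odot> b"
    "(a \<odot> u) \<odot> c = (1/2) *\<^sub>R (a \<odot> u)"
    "(b \<odot> u) \<odot> c = (1/2) *\<^sub>R (b \<odot> u)" "(u \<odot> a) \<odot> c = (1/2) *\<^sub>R (a \<odot> u)"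
    using assms by (auto simp: peirce_def comm[of _ c] comm[of u a])
  let ?X = "(a \<odot> b) \<odot> u" and ?A = "a \<odot> (b \<odot> u)" and ?B = "b \<odot> (a \<odot> u)"
  have "(1/2) *\<^sub>R ?A + (1/2) *\<^sub>R ?B + ?X = ?A + ?B + (1/2) *\<^sub>R ?X"
    using linearized_jordan[of a b u c]
    by (simp add: * distribs comm[of u "a \<odot> b"] comm[of u a] comm[of "b \<odot> u" a] comm[of "a \<odot> u" b])
  then have "2 *\<^sub>R ((1/2) *\<^sub>R ?A + (1/2) *\<^sub>R ?B + ?X) = 2 *\<^sub>R (?A + ?B + (1/2) *\<^sub>R ?X)"
    by (rule arg_cong)
  then show ?thesis by (simp add: scaleR_right_distrib) (simp add: scaleR_2)
qed

end

section \<open>The spectral theorem\<close>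

locale simple_formally_real_jordan = unital_jordan +
  assumes simple: "simple_algebra m"
    and square_sum_zero: "x \<odot> x + y \<odot> y = 0 \<Longrightarrow> x = 0"
begin

lemma square_zero: "x \<odot> x = 0 \<Longrightarrow> x = 0"
  using square_sum_zero[of x 0] by simp

lemma unit_nonzero: "e \<noteq> 0"
proof
  assume "e = 0"
  then have "x = 0" for x :: 'a by (metis unit zeros(1))
  then have "span {x \<odot> y |x y. True} = {0}" using span_0 by blast
  then show False using simple by (simp add: simple_algebra_def)
qed

lemma ideal_trivial:
  assumes "subspace I" "\<And>x y. y \<in> I \<Longrightarrow> x \<odot> y \<in> I" "z \<in> I" "z \<noteq> 0"
  shows "x \<in> I"
proof -
  have "algebra_ideal m I"
    using assms(1,2) unfolding algebra_ideal_def by (metis comm)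
  then show ?thesis using simple assms(3,4) unfolding simple_algebra_def by blast
qed

lemma peval_square_zero:
  assumes "p dvd q * q" "peval (m x) e p = 0"
  shows "peval (m x) e q = 0"
proof -
  obtain r where "q * q = p * r" using assms(1) by (auto simp: dvd_def)
  then have "peval (m x) e q \<odot> peval (m x) e q = 0"
    by (metis peval_m_mult assms(2) zeros(1))
  then show ?thesis by (rule square_zero)
qed

text \<open>
  The minimal polynomial \<open>p\<close> of \<open>x\<close> is a product of distinct real linear factors. For if it
  had a repeated real root, dropping one of the equal factors would give a polynomial whose square
  kills \<open>x\<close>; and if \<open>p = ((t - a)\<^sup>2 + b\<^sup>2) r\<close> with \<open>b \<noteq> 0\<close>, then the squares of \<open>(t - a) r\<close> and
  \<open>b r\<close> at \<open>x\<close> add up to zero.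
\<close>

lemma ex_split_annihilating_poly:
  obtains S where "finite S" "peval (m x) e (\<Prod>a\<in>S. [:- a, 1:]) = 0"
proof -
  let ?ev = "peval (m x) e"
  obtain p where p: "p \<noteq> 0" "?ev p = 0"
    "\<And>q. q \<noteq> 0 \<Longrightarrow> ?ev q = 0 \<Longrightarrow> degree p \<le> degree q"
    using ex_minimal_annihilating_poly[OF fin_dim linear_m] by metis
  have minimal: False if "?ev r = 0" "p = k * r" "degree k > 0" for k r
  proof -
    have "r \<noteq> 0" "k \<noteq> 0" using that p(1) by auto
    then show False using p(3)[OF \<open>r \<noteq> 0\<close> that(1)] that by (simp add: degree_mult_eq)
  qed
  let ?S = "{a. poly p a = 0}"
  have fin: "finite ?S" using p(1) by (rule poly_roots_finite)
  obtain q where q: "p = (\<Prod>a\<in>?S. [:- a, 1:]) * q"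
    using prod_linear_dvd[OF fin, of p] by (auto simp: dvd_def)
  have "degree q = 0"
  proof (rule ccontr)
    assume "degree q \<noteq> 0"
    then have "degree q > 0" by simp
    then show False
    proof (cases rule: real_poly_factor)
      case (1 a)
      then have "a \<in> ?S" by (subst q) (auto simp: poly_eq_0_iff_dvd)
      then have "[:- a, 1:] dvd (\<Prod>a\<in>?S. [:- a, 1:])" using fin by (intro dvd_prodI) auto
      then have "[:- a, 1:] * [:- a, 1:] dvd p" using 1 by (subst q) (rule mult_dvd_mono)
      then obtain r where r: "p = [:- a, 1:] * [:- a, 1:] * r" unfolding dvd_def by blast
      have "p dvd ([:- a, 1:] * r) * ([:- a, 1:] * r)"
        unfolding r dvd_def by (intro exI[of _ r]) (simp only: mult.assoc mult.left_commute)
      then have "?ev ([:- a, 1:] * r) = 0" using p(2) by (rule peval_square_zero)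
      moreover have "p = [:- a, 1:] * ([:- a, 1:] * r)" using r by (simp only: mult.assoc)
      ultimately show False by (rule minimal) simp
    next
      case (2 a b)
      then have "[:- a, 1:] * [:- a, 1:] + [:b * b:] dvd p" by (subst q) (rule dvd_mult)
      then obtain r where r: "p = ([:- a, 1:] * [:- a, 1:] + [:b * b:]) * r" unfolding dvd_def by blast
      have "([:- a, 1:] * r) * ([:- a, 1:] * r) + ([:b:] * r) * ([:b:] * r) = p * r"
      proof -
        have "(A * r) * (A * r) + (B * r) * (B * r) = ((A * A + B * B) * r) * r" for A B :: "real poly"
          by (simp add: algebra_simps)
        from this[of "[:- a, 1:]" "[:b:]"] show ?thesis unfolding r by simp
      qed
      then have "?ev (([:- a, 1:] * r) * ([:- a, 1:] * r) + ([:b:] * r) * ([:b:] * r)) = 0"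
        by (simp add: peval_m_mult p(2) del: mult_pCons_left)
      then have "?ev ([:b:] * r) \<odot> ?ev ([:b:] * r) + ?ev ([:- a, 1:] * r) \<odot> ?ev ([:- a, 1:] * r) = 0"
        by (simp only: peval_add[OF linear_m] peval_m_mult[of x "_ * r" "_ * r"] add.commute)
      then have "?ev ([:b:] * r) = 0" by (rule square_sum_zero)
      then have "?ev r = 0" using 2(1) by (simp add: peval_smult[OF linear_m])
      then show False using r by (rule minimal) simp
    qed
  qed
  then obtain k where k: "q = [:k:]" by (rule degree_eq_zeroE)
  have "k \<noteq> 0" using p(1) q k by auto
  moreover have "k *\<^sub>R ?ev (\<Prod>a\<in>?S. [:- a, 1:]) = 0"
    using p(2) by (subst (asm) q) (simp add: k mult.commute[of _ "[:k:]"] peval_smult[OF linear_m])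
  ultimately show ?thesis using fin by (intro that[of ?S]) auto
qed

text \<open>
  Lagrange interpolation at the roots produces the spectral idempotents: an identity between
  values of polynomials at \<open>x\<close> holds as soon as it holds at each root.
\<close>

lemma spectral_decomposition:
  obtains S c where "finite S" "S \<noteq> {}" "\<And>a. a \<in> S \<Longrightarrow> c a \<noteq> 0 \<and> idem (c a) \<and> x \<odot> c a = a *\<^sub>R c a"
    "(\<Sum>a\<in>S. c a) = e" "(\<Sum>a\<in>S. a *\<^sub>R c a) = x" "(\<Sum>a\<in>S. (a * a) *\<^sub>R c a) = x \<odot> x"
proof -
  let ?ev = "peval (m x) e"
  obtain R where R: "finite R" "?ev (\<Prod>a\<in>R. [:- a, 1:]) = 0"
    using ex_split_annihilating_poly by metis
  have vanish: "?ev q = 0" if "\<And>a. a \<in> R \<Longrightarrow> poly q a = 0" for q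
  proof -
    have "(\<Prod>a\<in>R. [:- a, 1:]) dvd q" using R(1) that by (rule prod_linear_dvd)
    then obtain r where "q = (\<Prod>a\<in>R. [:- a, 1:]) * r" by (auto simp: dvd_def)
    then show ?thesis using R(2) by (simp add: peval_m_mult)
  qed
  have eqI: "?ev p = ?ev q" if "\<And>a. a \<in> R \<Longrightarrow> poly p a = poly q a" for p q
    using vanish[of "p - q"] that by (simp add: peval_diff[OF linear_m])
  \<comment> \<open>The Lagrange basis of the node set \<open>R\<close>.\<close>
  define l where "l a = smult (1 / (\<Prod>b\<in>R - {a}. a - b)) (\<Prod>b\<in>R - {a}. [:- b, 1:])" for a
  have l: "poly (l a) b = (if b = a then 1 else 0)" if "a \<in> R" "b \<in> R" for a b
    using that R(1) by (auto simp: l_def poly_prod prod_zero_iff)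
  define c where "c a = ?ev (l a)" for a
  have one: "?ev 1 = e" by (subst one_pCons) (simp add: peval_pCons[OF linear_m])
  then have X: "?ev [:0, 1:] = x" by (simp add: peval_pCons[OF linear_m])
  have interp: "(\<Sum>a\<in>R. poly q a *\<^sub>R c a) = ?ev q" for q
  proof -
    have "(\<Sum>a\<in>R. poly q a *\<^sub>R c a) = ?ev (\<Sum>a\<in>R. smult (poly q a) (l a))"
      by (simp add: peval_sum[OF linear_m] peval_smult[OF linear_m] c_def)
    also have "\<dots> = ?ev q"
    proof (rule eqI)
      fix b assume b: "b \<in> R"
      have "poly (\<Sum>a\<in>R. smult (poly q a) (l a)) b = (\<Sum>a\<in>R. if b = a then poly q a else 0)"
        unfolding poly_sum using b by (intro sum.cong) (auto simp: l)
      then show "poly (\<Sum>a\<in>R. smult (poly q a) (l a)) b = poly q b" using b R(1) by simp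
    qed
    finally show ?thesis .
  qed
  \<comment> \<open>Roots with vanishing idempotent are dropped; this affects none of the sums.\<close>
  let ?S = "{a \<in> R. c a \<noteq> 0}"
  have interpS: "(\<Sum>a\<in>?S. poly q a *\<^sub>R c a) = ?ev q" for q
    unfolding interp[symmetric] using R(1) by (intro sum.mono_neutral_left) auto
  show ?thesis
  proof (rule that[of ?S c])
    show "finite ?S" using R(1) by simp
    show unit: "(\<Sum>a\<in>?S. c a) = e" using interpS[of 1] by (simp add: one)
    show "?S \<noteq> {}" using unit unit_nonzero by (metis sum.empty)
    show "(\<Sum>a\<in>?S. a *\<^sub>R c a) = x" using interpS[of "[:0, 1:]"] by (simp only: X) simp
    show "(\<Sum>a\<in>?S. (a * a) *\<^sub>R c a) = x \<odot> x"
      using interpS[of "[:0, 1:] * [:0, 1:]"] by (simp only: X peval_m_mult) simp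
    fix a assume a: "a \<in> ?S"
    have "?ev (l a * l a) = ?ev (l a)" using a by (intro eqI) (simp add: l)
    moreover have "?ev ([:0, 1:] * l a) = ?ev (smult a (l a))" using a by (intro eqI) (simp add: l)
    ultimately show "c a \<noteq> 0 \<and> idem (c a) \<and> x \<odot> c a = a *\<^sub>R c a"
      using a unfolding peval_m_mult by (simp add: X idem_def c_def peval_smult[OF linear_m])
  qed
qed

text \<open>The spectral theorem turns \<open>tr (x\<^sup>2)\<close> into a sum of squares weighted by traces of idempotents.\<close>

lemma inner_product_g: "inner_product g"
  unfolding inner_product_def
proof (intro conjI allI impI bilinear_g g_sym)
  fix x :: 'a assume "x \<noteq> 0"
  obtain S c where S: "finite S" "S \<noteq> {}" "\<And>a. a \<in> S \<Longrightarrow> c a \<noteq> 0 \<and> idem (c a) \<and> x \<odot> c a = a *\<^sub>R c a"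
    "(\<Sum>a\<in>S. c a) = e" "(\<Sum>a\<in>S. a *\<^sub>R c a) = x" "(\<Sum>a\<in>S. (a * a) *\<^sub>R c a) = x \<odot> x"
    by (rule spectral_decomposition[of x]) blast
  have "\<exists>a\<in>S. a \<noteq> 0"
  proof (rule ccontr)
    assume "\<not> (\<exists>a\<in>S. a \<noteq> 0)"
    then have "(\<Sum>a\<in>S. a *\<^sub>R c a) = 0" by (intro sum.neutral) auto
    then show False using S(5) \<open>x \<noteq> 0\<close> by simp
  qed
  then obtain a where a: "a \<in> S" "a \<noteq> 0" by blast
  have tr: "tr (c b) > 0" if "b \<in> S" for b using S(3)[OF that] tr_idem_pos by blast
  have "g x x = (\<Sum>a\<in>S. (a * a) * tr (c a))"
    unfolding g_def S(6)[symmetric] by (simp add: linear_sum[OF linear_tr] linear_cmul[OF linear_tr])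
  also have "\<dots> > 0"
  proof (rule sum_pos2[OF S(1) a(1)])
    show "a * a * tr (c a) > 0" 
      using a(2) tr[OF a(1)] not_real_square_gt_zero[of a] mult_pos_pos[of "a * a" "tr (c a)"] by blast
    show "b * b * tr (c b) \<ge> 0" if "b \<in> S" for b using tr[OF that] by simp
  qed
  finally show "g x x > 0" .
qed

lemma g_pos: "x \<noteq> 0 \<Longrightarrow> g x x > 0"
  using inner_product_g by (simp add: inner_product_def)

lemma g_zero_iff [simp]: "g x x = 0 \<longleftrightarrow> x = 0"
  using g_pos[of x] by (cases "x = 0") auto

lemma g_nonneg: "g x x \<ge> 0"
  using g_pos[of x] by (cases "x = 0") auto

lemma peirce_orthogonal:
  assumes "x \<in> peirce c k" "y \<in> peirce c l" "k \<noteq> l"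
  shows "g x y = 0"
proof -
  have "g (c \<odot> x) y = g x (c \<odot> y)" by (rule g_assoc)
  then show ?thesis using assms by (simp add: peirce_def g_distribs)
qed

lemma idem_psd:
  assumes "idem c"
  shows "g (c \<odot> x) x \<ge> 0"
proof -
  obtain x1 xh x0 where x: "x = x1 + xh + x0" "x1 \<in> peirce c 1" "xh \<in> peirce c (1/2)" "x0 \<in> peirce c 0"
    using peirce_decomposition[OF assms] .
  have o: "g x1 xh = 0" "g x1 x0 = 0" "g xh x1 = 0" "g xh x0 = 0"
    using x peirce_orthogonal by auto
  have c: "c \<odot> x1 = x1" "c \<odot> xh = (1/2) *\<^sub>R xh" "c \<odot> x0 = 0" using x by (auto simp: peirce_def)
  have "g (c \<odot> x) x = g x1 x1 + g xh xh / 2"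
    by (simp add: x(1) distribs c g_distribs o)
  then show ?thesis using g_nonneg[of x1] g_nonneg[of xh] by simp
qed

section \<open>Irreducibility of the traceless part\<close>

definition deriv_invariant :: "'a set \<Rightarrow> bool" where
  "deriv_invariant E \<longleftrightarrow> subspace E \<and> (\<forall>a b. \<forall>x\<in>E. inner_deriv a b x \<in> E)"

text \<open>Otherwise \<open>A\<close> is the direct product of its Peirce spaces for \<open>1\<close> and \<open>0\<close>.\<close>

lemma peirce_half_nonzero:
  assumes c: "idem c" "c \<noteq> 0" "c \<noteq> e"
  obtains u where "u \<in> peirce c (1/2)" "u \<noteq> 0"
proof (rule ccontr)
  assume "\<not> thesis"
  with that have U: "u = 0" if "u \<in> peirce c (1/2)" for u using \<open>u \<in> _\<close> by blast
  have "e \<in> peirce c 1"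
  proof (rule ideal_trivial)
    show "subspace (peirce c 1)" by (rule subspace_peirce)
    show "c \<in> peirce c 1" "c \<noteq> 0" using c by (auto simp: peirce_def idem_def)
    fix x y assume y: "y \<in> peirce c 1"
    obtain x1 xh x0 where x: "x = x1 + xh + x0" "x1 \<in> peirce c 1" "xh \<in> peirce c (1/2)" "x0 \<in> peirce c 0"
      using peirce_decomposition[OF c(1)] .
    have "x \<odot> y = x1 \<odot> y"
      using U[OF x(3)] peirce_1_0[OF c(1) y x(4)] by (simp add: x(1) distribs comm[of x0 y])
    then show "x \<odot> y \<in> peirce c 1" using peirce_mult[OF c(1) x(2) _ y] by simp
  qed
  then show False using c(3) by (simp add: peirce_def)
qed

text \<open>
  Let \<open>c\<close> be the spectral idempotent of \<open>z\<close> for its largest eigenvalue \<open>l\<close>. On the half space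
  of \<open>c\<close> the map \<open>\<phi> u = [L c, L u] z = (z u - l u) / 2\<close> is selfadjoint, takes values in \<open>E\<close>, and
  is injective because \<open>l e - z\<close> is a positive combination of the other spectral idempotents. So a vector
  of the half space orthogonal to the part in \<open>E\<close>, hence to the image of \<open>\<phi>\<close>, vanishes.
\<close>

lemma ex_idem_half_subset:
  assumes E: "deriv_invariant E" and z: "z \<in> E" "z \<noteq> 0" "tr z = 0"
  obtains c where "idem c" "c \<noteq> 0" "c \<noteq> e" "peirce c (1/2) \<subseteq> E"
proof -
  obtain S c where S: "finite S" "S \<noteq> {}" "\<And>a. a \<in> S \<Longrightarrow> c a \<noteq> 0 \<and> idem (c a) \<and> z \<odot> c a = a *\<^sub>R c a"
    "(\<Sum>a\<in>S. c a) = e" "(\<Sum>a\<in>S. a *\<^sub>R c a) = z" "(\<Sum>a\<in>S. (a * a) *\<^sub>R c a) = z \<odot> z"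
    by (rule spectral_decomposition[of z]) blast
  define l where "l = Max S"
  define d where "d = c l"
  have l: "l \<in> S" "\<And>a. a \<in> S \<Longrightarrow> a \<le> l" using S(1,2) by (auto simp: l_def)
  have d: "idem d" "d \<noteq> 0" "z \<odot> d = l *\<^sub>R d" using S(3)[OF l(1)] by (auto simp: d_def)
  have "d \<noteq> e"
  proof
    assume "d = e"
    then have "z = l *\<^sub>R e" using d(3) by simp
    moreover have "tr e > 0" using tr_idem_pos[of e] unit_nonzero by (simp add: idem_def)
    ultimately show False using z(2,3) by (simp add: linear_cmul[OF linear_tr])
  qed
  let ?U = "peirce d (1/2)"
  define \<phi> where "\<phi> u = inner_deriv d u z" for u
  have z0: "z - l *\<^sub>R d \<in> peirce d 0"
    using d by (simp add: peirce_def distribs comm[of d z] idem_def)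
  have \<phi>: "\<phi> u = (1/2) *\<^sub>R (z \<odot> u - l *\<^sub>R u)" "\<phi> u \<in> ?U" if "u \<in> ?U" for u
  proof -
    have du: "d \<odot> u = (1/2) *\<^sub>R u" using that by (simp add: peirce_def)
    have "(z - l *\<^sub>R d) \<odot> u \<in> ?U" using peirce_mult[OF d(1) z0 _ that] by simp
    then have "(z - l *\<^sub>R d) \<odot> u + (l * (1/2)) *\<^sub>R u \<in> ?U"
      using that subspace_peirce by (intro subspace_add subspace_scale)
    then have zu: "z \<odot> u \<in> ?U" by (simp add: distribs du)
    then show 1: "\<phi> u = (1/2) *\<^sub>R (z \<odot> u - l *\<^sub>R u)"
      by (simp add: \<phi>_def inner_deriv_def comm[of u z] comm[of d z] d(3) distribs comm[of u d] du)
         (simp add: peirce_def algebra_simps)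
    show "\<phi> u \<in> ?U" unfolding 1
      using zu that subspace_peirce by (intro subspace_scale subspace_diff)
  qed
  have \<phi>E: "\<phi> u \<in> E" for u using E z(1) by (simp add: \<phi>_def deriv_invariant_def)
  have inj: "u = 0" if u: "u \<in> ?U" "\<phi> u = 0" for u
  proof -
    have "z \<odot> u = l *\<^sub>R u" using \<phi>(1)[OF u(1)] u(2) by simp
    have bl: "linear (\<lambda>w. g (w \<odot> u) u)"
      by (intro linearI) (simp_all add: distribs g_distribs)
    have "(\<Sum>a\<in>S. (l - a) * g (c a \<odot> u) u) = l * (\<Sum>a\<in>S. g (c a \<odot> u) u) - (\<Sum>a\<in>S. a * g (c a \<odot> u) u)"
      by (simp add: left_diff_distrib sum_subtractf sum_distrib_left)
    also have "(\<Sum>a\<in>S. g (c a \<odot> u) u) = g u u"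
      using linear_sum[OF bl, of c S] S(4) by simp
    also have "(\<Sum>a\<in>S. a * g (c a \<odot> u) u) = g (z \<odot> u) u"
      using linear_sum[OF bl, of "\<lambda>a. a *\<^sub>R c a" S] S(5) by (simp add: linear_cmul[OF bl])
    finally have s0: "(\<Sum>a\<in>S. (l - a) * g (c a \<odot> u) u) = 0"
      by (simp add: \<open>z \<odot> u = _\<close> g_distribs)
    have nn: "(l - a) * g (c a \<odot> u) u \<ge> 0" if "a \<in> S" for a
      using idem_psd[of "c a" u] S(3)[OF that] l(2)[OF that] by simp
    have "(l - a) * g (c a \<odot> u) u = 0" if "a \<in> S" for a
      using sum_nonneg_eq_0_iff[OF S(1), of "\<lambda>a. (l - a) * g (c a \<odot> u) u"] nn s0 that by simp
    then have "g (c a \<odot> u) u = 0" if "a \<in> S - {l}" for a using that by force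
    then have "(\<Sum>a\<in>S. g (c a \<odot> u) u) = g (d \<odot> u) u"
      using S(1) l(1) by (subst sum.remove[of S l]) (auto simp: d_def)
    moreover have "(\<Sum>a\<in>S. g (c a \<odot> u) u) = g u u"
      using linear_sum[OF bl, of c S] S(4) by simp
    ultimately have "g u u = g u u / 2" using u(1) by (simp add: peirce_def g_distribs)
    then show ?thesis by simp
  qed
  have "?U \<subseteq> E"
  proof
    fix u assume u: "u \<in> ?U"
    let ?W = "?U \<inter> E"
    have W: "subspace ?W" using subspace_peirce E by (auto simp: deriv_invariant_def intro: subspace_inter)
    obtain p where p: "p \<in> ?W" "\<And>y. y \<in> ?W \<Longrightarrow> g (u - p) y = 0"
      using ex_orthogonal_projection[OF fin_dim inner_product_g W] by metis
    define r where "r = u - p"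
    have r: "r \<in> ?U" unfolding r_def using u p(1) subspace_peirce by (auto intro: subspace_diff)
    have sa: "g (\<phi> v) w = g v (\<phi> w)" if "v \<in> ?U" "w \<in> ?U" for v w
      by (simp add: \<phi>(1)[OF that(1)] \<phi>(1)[OF that(2)] g_distribs g_assoc)
    have "g (\<phi> r) (\<phi> r) = g r (\<phi> (\<phi> r))" using sa[OF r \<phi>(2)[OF r]] .
    also have "\<dots> = 0" using p(2) \<phi>(2)[OF \<phi>(2)[OF r]] \<phi>E by (simp add: r_def)
    finally have "r = 0" using inj[OF r] by simp
    then show "u \<in> E" using p(1) by (simp add: r_def)
  qed
  then show ?thesis using that d \<open>d \<noteq> e\<close> by blast
qed

text \<open>By pair symmetry, orthogonality of invariant subspaces forces their elements to operator-commute.\<close>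

lemma deriv_orthogonal_invariant:
  assumes "deriv_invariant E" "z \<in> E" "\<And>x. x \<in> E \<Longrightarrow> g x w = 0"
  shows "inner_deriv z w y = 0"
proof -
  have "g (inner_deriv z w y) (inner_deriv z w y) = 0"
    unfolding g_deriv_pair_symmetry[of z w y "inner_deriv z w y"] using assms by (simp add: deriv_invariant_def)
  then show ?thesis by simp
qed

text \<open>
  Because \<open>A_1\<close> acts on the half space by a Jordan homomorphism, the kernel of this action is an
  ideal of \<open>A\<close>; it does not contain \<open>c\<close>.
\<close>

lemma peirce_half_faithful:
  assumes c: "idem c" "c \<noteq> 0" "c \<noteq> e" and a: "a \<in> peirce c 1"
    and ann: "\<And>u. u \<in> peirce c (1/2) \<Longrightarrow> a \<odot> u = 0"
  shows "a = 0"
proof (rule ccontr)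
  assume "a \<noteq> 0"
  let ?J = "{a \<in> peirce c 1. \<forall>u\<in>peirce c (1/2). a \<odot> u = 0}"
  have "c \<in> ?J"
  proof (rule ideal_trivial)
    show "subspace ?J"
      using subspace_peirce[of c 1] by (auto simp: subspace_def distribs)
    show "a \<in> ?J" using a ann by simp
    fix x b assume b: "b \<in> ?J"
    obtain x1 xh x0 where x: "x = x1 + xh + x0" "x1 \<in> peirce c 1" "xh \<in> peirce c (1/2)" "x0 \<in> peirce c 0"
      using peirce_decomposition[OF c(1)] .
    have "b \<odot> xh = 0" "b \<odot> x0 = 0" using b x peirce_1_0[OF c(1) _ x(4)] by auto
    then have xb: "x \<odot> b = x1 \<odot> b" by (simp add: x(1) distribs comm[of _ b])
    have "(x1 \<odot> b) \<odot> u = 0" if u: "u \<in> peirce c (1/2)" for u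
      using b u peirce_half_module[OF c(1) x(2) _ u] peirce_mult[OF c(1) x(2) _ u] by auto
    moreover have "x1 \<odot> b \<in> peirce c 1" using b peirce_mult[OF c(1) x(2)] by simp
    ultimately show "x \<odot> b \<in> ?J" by (simp add: xb)
  qed fact
  moreover obtain u where "u \<in> peirce c (1/2)" "u \<noteq> 0" using peirce_half_nonzero[OF c] .
  ultimately show False by (auto simp: peirce_def)
qed

text \<open>
  Write \<open>w = w\<^sub>1 + w\<^sub>0\<close>; there is no middle component, as it lies in \<open>E\<close>. The vectors \<open>[L a, L u] w\<close>
  with \<open>a\<close> in \<open>A_1\<close> and \<open>u\<close> in the half space lie in the half space, hence in \<open>E\<close>, and also in
  \<open>F\<close>; so they vanish. With \<open>a = c\<close> this says \<open>w u = 2 w\<^sub>1 u\<close>, and then in general that the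
  derivation \<open>[L a, L w]\<close> kills the half space. It also kills \<open>c\<close>, so it preserves \<open>A_1\<close> and
  \<open>A_0 = peirce c 0\<close>, on which it vanishes because these act faithfully on the half space.
\<close>

lemma deriv_one_zero:
  assumes E: "deriv_invariant E" and F: "deriv_invariant F"
    and orth: "\<And>x y. x \<in> E \<Longrightarrow> y \<in> F \<Longrightarrow> g x y = 0"
    and c: "idem c" "c \<noteq> 0" "c \<noteq> e" "peirce c (1/2) \<subseteq> E"
    and a: "a \<in> peirce c 1" and w: "w \<in> F"
  shows "inner_deriv a w x = 0"
proof -
  let ?U = "peirce c (1/2)"
  obtain w1 wh w0 where W: "w = w1 + wh + w0" "w1 \<in> peirce c 1" "wh \<in> ?U" "w0 \<in> peirce c 0"
    using peirce_decomposition[OF c(1)] .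
  have "g wh w = g wh wh"
    using peirce_orthogonal[OF W(3) W(2)] peirce_orthogonal[OF W(3) W(4)] by (simp add: W(1) g_distribs)
  moreover have "g wh w = 0" using W(3) c(4) orth w by blast
  ultimately have w10: "w = w1 + w0" using W(1) by simp
  have UF: "x = 0" if "x \<in> ?U" "x \<in> F" for x
    using orth[of x x] that c(4) by auto
  have der: "a \<odot> (w \<odot> u) = u \<odot> (a \<odot> w1)" if a: "a \<in> peirce c 1" and u: "u \<in> ?U" for a u
  proof -
    have "w1 \<odot> u \<in> ?U" "w0 \<odot> u \<in> ?U" using peirce_mult[OF c(1)] W u by blast+
    then have "u \<odot> w \<in> ?U" using subspace_peirce by (simp add: w10 distribs comm[of u] subspace_add)
    then have "a \<odot> (u \<odot> w) \<in> ?U" using peirce_mult[OF c(1) a] by simp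
    moreover have aw: "a \<odot> w = a \<odot> w1" using peirce_1_0[OF c(1) a W(4)] by (simp add: w10 distribs)
    have "u \<odot> (a \<odot> w1) \<in> ?U"
      using peirce_mult[OF c(1) peirce_mult[OF c(1) a _ W(2)] _ u] by (simp add: comm[of u])
    ultimately have "inner_deriv a u w \<in> ?U"
      using subspace_peirce by (simp add: inner_deriv_def aw subspace_diff)
    moreover have "inner_deriv a u w \<in> F" using F w by (simp add: deriv_invariant_def)
    ultimately have "inner_deriv a u w = 0" by (rule UF)
    then show ?thesis by (simp add: inner_deriv_def aw comm[of u w])
  qed
  have cc: "c \<in> peirce c 1" using c(1) by (simp add: peirce_def idem_def)
  have wu: "w \<odot> u = 2 *\<^sub>R (w1 \<odot> u)" if u: "u \<in> ?U" for u
  proof -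
    have "c \<odot> w1 = w1" using W(2) by (simp add: peirce_def)
    moreover have "w1 \<odot> u \<in> ?U" "w0 \<odot> u \<in> ?U" using peirce_mult[OF c(1)] W u by blast+
    then have "w \<odot> u \<in> ?U" using subspace_peirce by (simp add: w10 distribs subspace_add)
    then have "c \<odot> (w \<odot> u) = (1/2) *\<^sub>R (w \<odot> u)" by (simp add: peirce_def)
    ultimately have half: "(1/2) *\<^sub>R (w \<odot> u) = w1 \<odot> u" using der[OF cc u] by (simp add: comm[of u])
    then show ?thesis by (simp flip: half)
  qed
  let ?D = "inner_deriv a w"
  have DU: "?D u = 0" if u: "u \<in> ?U" for u
  proof -
    have au: "a \<odot> u \<in> ?U" using peirce_mult[OF c(1) a _ u] by simp
    have "2 *\<^sub>R (a \<odot> (w1 \<odot> u)) = (a \<odot> w1) \<odot> u"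
      using der[OF a u] by (simp add: wu[OF u] distribs comm[of u])
    then have "a \<odot> (w1 \<odot> u) = w1 \<odot> (a \<odot> u)"
      using peirce_half_module[OF c(1) a W(2) u] by (simp add: scaleR_2)
    then show ?thesis by (simp add: inner_deriv_def wu[OF u] wu[OF au] distribs)
  qed
  have "a \<odot> c = a" "w \<odot> c = w1" "a \<odot> w0 = 0"
    using a W peirce_1_0[OF c(1) a W(4)] by (auto simp: w10 distribs comm[of _ c] peirce_def)
  then have Dc: "?D c = 0" by (simp add: inner_deriv_def w10 distribs comm[of a])
  then have Dk: "?D x \<in> peirce c k" if "x \<in> peirce c k" for x k
    using deriv_product[of a w c x] that linear_cmul[OF linear_deriv[of a w], of k x] by (simp add: peirce_def)
  have D1: "?D x \<odot> u = 0" if "x \<in> peirce c k" "k = 0 \<or> k = 1" "u \<in> ?U" for x u k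
    using deriv_product[of a w x u] DU[OF that(3)] DU[OF peirce_mult[OF c(1) that]] by simp
  have one: "?D x = 0" if x: "x \<in> peirce c 1" for x
    using peirce_half_faithful[OF c(1-3) Dk[OF x]] D1[OF x] by blast
  have zero: "?D x = 0" if x: "x \<in> peirce c 0" for x
  proof (rule peirce_half_faithful)
    show "idem (e - c)" "e - c \<noteq> 0" "e - c \<noteq> e" using c by (auto simp: idem_complement)
    show "?D x \<in> peirce (e - c) 1" using Dk[OF x] by (simp add: peirce_complement)
    show "?D x \<odot> u = 0" if "u \<in> peirce (e - c) (1/2)" for u
      using D1[OF x] that by (simp add: peirce_complement)
  qed
  obtain x1 xh x0 where "x = x1 + xh + x0" "x1 \<in> peirce c 1" "xh \<in> ?U" "x0 \<in> peirce c 0"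
    using peirce_decomposition[OF c(1)] .
  then show ?thesis by (simp add: linear_add[OF linear_deriv] one zero DU)
qed

text \<open>The eigenspaces of multiplication by a central element are ideals.\<close>

lemma central_traceless_zero:
  assumes "\<And>a x. inner_deriv a w x = 0" and "tr w = 0"
  shows "w = 0"
proof -
  obtain S c where S: "S \<noteq> {}" "\<And>a. a \<in> S \<Longrightarrow> c a \<noteq> 0 \<and> idem (c a) \<and> w \<odot> c a = a *\<^sub>R c a"
    by (rule spectral_decomposition[of w]) blast
  then obtain l where l: "l \<in> S" by blast
  have "e \<in> {x. w \<odot> x = l *\<^sub>R x}"
  proof (rule ideal_trivial)
    show "subspace {x. w \<odot> x = l *\<^sub>R x}" using subspace_peirce[of w l] by (simp add: peirce_def)
    show "c l \<in> {x. w \<odot> x = l *\<^sub>R x}" "c l \<noteq> 0" using S(2)[OF l] by auto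
    show "x \<odot> y \<in> {x. w \<odot> x = l *\<^sub>R x}" if "y \<in> {x. w \<odot> x = l *\<^sub>R x}" for x y
      using assms(1)[of x y] that by (simp add: inner_deriv_def distribs)
  qed
  then have w: "w = l *\<^sub>R e" by simp
  moreover have "tr e > 0" using tr_idem_pos[of e] unit_nonzero by (simp add: idem_def)
  ultimately show ?thesis using assms(2) by (auto simp: linear_cmul[OF linear_tr])
qed

lemma traceless_irreducible:
  assumes E: "deriv_invariant E" "\<And>x. x \<in> E \<Longrightarrow> tr x = 0" "z \<in> E" "z \<noteq> 0" and x: "tr x = 0"
  shows "x \<in> E"
proof -
  let ?F = "{w. tr w = 0 \<and> (\<forall>y\<in>E. g y w = 0)}"
  have F: "deriv_invariant ?F"
    unfolding deriv_invariant_def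
  proof (intro conjI allI ballI)
    show "subspace ?F"
      by (auto simp: subspace_def linear_0[OF linear_tr] linear_add[OF linear_tr] linear_cmul[OF linear_tr] g_distribs)
    show "inner_deriv a b w \<in> ?F" if "w \<in> ?F" for a b w
    proof -
      have "g y (inner_deriv a b w) = - g (inner_deriv a b y) w" for y by (simp add: g_deriv)
      then show ?thesis using that E(1) by (simp add: tr_deriv deriv_invariant_def)
    qed
  qed
  obtain c where c: "idem c" "c \<noteq> 0" "c \<noteq> e" "peirce c (1/2) \<subseteq> E"
    using ex_idem_half_subset[OF E(1,3,4) E(2)[OF E(3)]] .
  have F0: "w = 0" if w: "w \<in> ?F" for w
  proof (rule central_traceless_zero)
    show "tr w = 0" using w by simp
    fix a y
    obtain a1 ah a0 where a: "a = a1 + ah + a0" "a1 \<in> peirce c 1" "ah \<in> peirce c (1/2)" "a0 \<in> peirce c 0"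
      using peirce_decomposition[OF c(1)] .
    have "inner_deriv a1 w y = 0" using deriv_one_zero[OF E(1) F _ c a(2) w] by simp
    moreover have "inner_deriv ah w y = 0" using deriv_orthogonal_invariant[OF E(1)] a(3) c(4) w by blast
    moreover have "inner_deriv a0 w y = 0"
    proof (rule deriv_one_zero[OF E(1) F])
      show "idem (e - c)" "e - c \<noteq> 0" "e - c \<noteq> e" using c by (auto simp: idem_complement)
      show "peirce (e - c) (1/2) \<subseteq> E" "a0 \<in> peirce (e - c) 1" "w \<in> ?F"
        using c a(4) w by (simp_all add: peirce_complement)
    qed simp
    moreover have "inner_deriv a w y = inner_deriv a1 w y + inner_deriv ah w y + inner_deriv a0 w y"
      by (simp add: a(1) inner_deriv_def distribs)
    ultimately show "inner_deriv a w y = 0" by simp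
  qed
  obtain p where p: "p \<in> E" "\<And>y. y \<in> E \<Longrightarrow> g (x - p) y = 0"
    using ex_orthogonal_projection[OF fin_dim inner_product_g] E(1) unfolding deriv_invariant_def by metis
  have "x - p \<in> ?F" using p x E(2) by (simp add: linear_diff[OF linear_tr] g_sym[of _ "x - p"])
  then have "x = p" using F0 by fastforce
  then show ?thesis using p(1) by simp
qed

text \<open>
  Schur's lemma for the selfadjoint operator representing \<open>\<beta>\<close>: it fixes \<open>e\<close>, and on the
  traceless part an eigenspace is invariant under all inner derivations. Its eigenvalue is
  nonnegative because \<open>\<beta> z z\<close> is the trace of the square of the selfadjoint \<open>L z\<close>.
\<close>

lemma \<beta>_eq:
  obtains \<alpha> \<gamma> where "\<alpha> \<ge> 0" "\<alpha> + \<gamma> * tr e = 1" "\<And>x y. \<beta> x y = \<alpha> * g x y + \<gamma> * tr x * tr y"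
proof -
  have "\<exists>w. \<forall>y. g w y = \<beta> x y" for x
  proof -
    obtain B :: "'a set" where "finite B" "span B = UNIV" using fin_dim by (auto simp: fin_dim_def)
    then show ?thesis using riesz_on_span[OF inner_product_g _ linear_\<beta>, of B x] by auto
  qed
  then obtain T where T: "\<And>x y. g (T x) y = \<beta> x y" by metis
  have ext: "x = y" if "\<And>z. g x z = g y z" for x y using inner_product_ext[OF inner_product_g] that .
  have lT: "linear T"
    by (intro linearI ext)
       (simp_all add: T g_distribs \<beta>_sym[of _ "_ :: 'a"] linear_add[OF linear_\<beta>] linear_cmul[OF linear_\<beta>])
  have sT: "g (T x) y = g x (T y)" for x y by (metis T \<beta>_sym g_sym)
  have Te: "T e = e" by (intro ext) (simp add: T)
  have Td: "T (inner_deriv a b x) = inner_deriv a b (T x)" for a b x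
    by (intro ext) (simp add: T \<beta>_deriv g_deriv)
  have trT: "tr (T x) = tr x" for x using sT[of e x] by (simp add: Te)
  have tre: "tr e > 0" using tr_idem_pos[of e] unit_nonzero by (simp add: idem_def)
  show ?thesis
  proof (cases "\<exists>v. tr v = 0 \<and> v \<noteq> 0")
    case True
    then obtain v where v: "v \<in> {x. tr x = 0}" "v \<noteq> 0" by auto
    have "subspace {x. tr x = 0}"
      by (auto simp: subspace_def linear_0[OF linear_tr] linear_add[OF linear_tr] linear_cmul[OF linear_tr])
    then obtain z \<alpha> where z: "tr z = 0" "z \<noteq> 0" "T z = \<alpha> *\<^sub>R z"
      using ex_eigenvector_selfadjoint[OF fin_dim inner_product_g lT sT _ _ v] by (auto simp: trT)
    let ?E = "{x. tr x = 0 \<and> T x = \<alpha> *\<^sub>R x}"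
    have E: "deriv_invariant ?E"
      by (auto simp: deriv_invariant_def subspace_def linear_0[OF linear_tr] linear_add[OF linear_tr]
        linear_cmul[OF linear_tr] linear_0[OF lT] linear_add[OF lT] linear_cmul[OF lT] tr_deriv Td
        linear_cmul[OF linear_deriv] algebra_simps)
    have T0: "T x = \<alpha> *\<^sub>R x" if "tr x = 0" for x
      using traceless_irreducible[OF E _ _ z(2) that] z by simp
    \<comment> \<open>Forced by \<open>\<beta> e x = tr x\<close>.\<close>
    define \<gamma> where "\<gamma> = (1 - \<alpha>) / tr e"
    show ?thesis
    proof (rule that)
      show "\<alpha> + \<gamma> * tr e = 1" using tre by (simp add: \<gamma>_def)
      show "\<beta> x y = \<alpha> * g x y + \<gamma> * tr x * tr y" for x y
      proof -
        let ?k = "tr x / tr e"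
        have "tr (x - ?k *\<^sub>R e) = 0" using tre by (simp add: linear_diff[OF linear_tr] linear_cmul[OF linear_tr])
        from T0[OF this] have "T x = ?k *\<^sub>R e + \<alpha> *\<^sub>R (x - ?k *\<^sub>R e)"
          by (simp add: linear_diff[OF lT] linear_cmul[OF lT] Te algebra_simps)
        then have "\<beta> x y = g (?k *\<^sub>R e + \<alpha> *\<^sub>R (x - ?k *\<^sub>R e)) y" using T[of x y] by simp
        also have "\<dots> = \<alpha> * g x y + \<gamma> * tr x * tr y"
          using tre by (simp add: g_distribs \<gamma>_def field_simps)
        finally show ?thesis .
      qed
      have "\<alpha> * g z z = \<beta> z z" using T[of z z] by (simp add: z(3) g_distribs)
      moreover have "\<beta> z z \<ge> 0"
        unfolding \<beta>_def by (intro lin_trace_square_selfadjoint[OF fin_dim inner_product_g linear_m]) (rule g_assoc)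
      ultimately show "\<alpha> \<ge> 0" using g_pos[OF z(2)] by (metis zero_le_mult_iff not_le order_less_imp_le)
    qed
  next
    \<comment> \<open>The one-dimensional algebra, where \<open>g\<close> and \<open>tr \<otimes> tr\<close> are proportional.\<close>
    case False
    show ?thesis
    proof (rule that[of 1 0])
      show "\<beta> x y = 1 * g x y + 0 * tr x * tr y" for x y
      proof -
        let ?k = "tr x / tr e"
        have "tr (x - ?k *\<^sub>R e) = 0" using tre by (simp add: linear_diff[OF linear_tr] linear_cmul[OF linear_tr])
        then have "x = ?k *\<^sub>R e" using False by auto
        then have "T x = x" using linear_cmul[OF lT, of ?k e] Te by metis
        then show ?thesis using T[of x y] by simp
      qed
    qed simp_all
  qed
qed

section \<open>The Einstein metric\<close>

text \<open>
  The trace form rescaled along \<open>e\<close>: on traceless elements \<open>h s\<close> is \<open>g\<close>, and \<open>h s e e = n (1 + s n)\<close>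
  for \<open>n = tr e\<close>. The product \<open>N s\<close> is its Jordan-Levi-Civita connection.
\<close>

definition h :: "real \<Rightarrow> 'a \<Rightarrow> 'a \<Rightarrow> real" where
  "h s x y = g x y + s * (tr x * tr y)"

definition N :: "real \<Rightarrow> 'a \<Rightarrow> 'a \<Rightarrow> 'a" where
  "N s x y = (1/2) *\<^sub>R (x \<odot> y + s *\<^sub>R (tr y *\<^sub>R x - tr x *\<^sub>R y))"

lemmas tr_linear = linear_add[OF linear_tr] linear_diff[OF linear_tr] linear_cmul[OF linear_tr]

lemma tr_unit_pos: "tr e > 0"
  using tr_idem_pos[of e] unit_nonzero by (simp add: idem_def)

text \<open>For negative \<open>s\<close> this is the Cauchy-Schwarz inequality \<open>(tr x)\<^sup>2 \<le> n g x x\<close> for \<open>x\<close> and \<open>e\<close>.\<close>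

lemma inner_product_h:
  assumes "1 + s * tr e > 0"
  shows "inner_product (h s)"
  unfolding inner_product_def
proof (intro conjI allI impI)
  show "bilinear (h s)"
    unfolding bilinear_def h_def
    by (auto intro!: linearI simp: g_distribs tr_linear algebra_simps)
  show "h s x y = h s y x" for x y by (simp add: h_def g_sym)
  fix x :: 'a assume "x \<noteq> 0"
  have "0 \<le> g (x - (tr x / tr e) *\<^sub>R e) (x - (tr x / tr e) *\<^sub>R e)" by (rule g_nonneg)
  also have "\<dots> = g x x - tr x * tr x / tr e"
    using tr_unit_pos by (simp add: g_distribs tr_linear field_simps)
  finally have cs: "tr x * tr x \<le> tr e * g x x" using tr_unit_pos by (simp add: field_simps)
  show "h s x x > 0"
  proof (cases "s \<ge> 0")
    case True
    then show ?thesis using g_pos[OF \<open>x \<noteq> 0\<close>] by (simp add: h_def add_pos_nonneg)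
  next
    case False
    then have "s * (tr e * g x x) \<le> s * (tr x * tr x)" using cs by (simp add: mult_left_mono_neg)
    moreover have "(1 + s * tr e) * g x x > 0" using assms g_pos[OF \<open>x \<noteq> 0\<close>] by simp
    ultimately show ?thesis by (simp add: h_def algebra_simps)
  qed
qed

lemma bilinear_N: "bilinear (N s)"
  unfolding bilinear_def N_def
  by (auto intro!: linearI simp: distribs tr_linear add_divide_distrib algebra_simps)

lemma levi_civita_h:
  assumes "1 + s * tr e > 0"
  shows "jordan_levi_civita m (h s) = N s"
proof -
  have "is_jordan_levi_civita m (h s) (N s)"
    unfolding is_jordan_levi_civita_def
  proof (intro conjI allI)
    show "bilinear (N s)" by (rule bilinear_N)
    show "N s x y + N s y x = x \<odot> y" for x y
      by (simp add: N_def comm[of y x] algebra_simps flip: scaleR_add_left)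
    show "h s (N s x y) z = h s y (N s x z)" for x y z
    proof -
      have t: "tr (x \<odot> y) = g x y" "tr (x \<odot> z) = g x z" by (simp_all add: g_def)
      have "g y (x \<odot> z) = g (x \<odot> y) z" by (simp add: g_assoc)
      then show ?thesis
        by (simp add: h_def N_def g_distribs tr_linear t g_sym[of y x] algebra_simps)
    qed
  qed
  then show ?thesis
    unfolding jordan_levi_civita_def
    using is_jordan_levi_civita_ex1[OF fin_dim inner_product_h[OF assms] bilinear_m comm]
    by (rule the1_equality[rotated])
qed

lemma linear_rank_one: "linear (\<lambda>x. tr x *\<^sub>R v)" "linear (\<lambda>x. g u x *\<^sub>R v)"
  by (auto intro!: linearI simp: tr_linear g_distribs algebra_simps)

lemma trace_rank_one: "lin_trace (\<lambda>x. tr x *\<^sub>R v) = tr v" "lin_trace (\<lambda>x. g u x *\<^sub>R v) = g u v"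
  using lin_trace_rank_one[OF fin_dim linear_tr, of v]
    lin_trace_rank_one[OF fin_dim, of "g u" v] bilinear_g by (simp_all add: bilinear_def)

lemma trace_basic: "lin_trace (\<lambda>x::'a. x) = tr e" "lin_trace (\<lambda>x. u \<odot> x) = tr u"
  "lin_trace (\<lambda>x. u \<odot> (v \<odot> x)) = \<beta> u v"
proof -
  have "m e = (\<lambda>x. x)" by (rule ext) simp
  then show "lin_trace (\<lambda>x::'a. x) = tr e" by (simp add: tr_def)
qed (simp_all add: tr_def \<beta>_def)

lemmas traces = trace_simps trace_rank_one trace_basic linear_intros linear_rank_one linear_ident

lemma trace_N_left: "lin_trace (\<lambda>x. N s x w) = (1 + s * (tr e - 1)) / 2 * tr w"
proof -
  have "lin_trace (\<lambda>x. N s x w)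
      = lin_trace (\<lambda>x. (1/2) *\<^sub>R (w \<odot> x + s *\<^sub>R (tr w *\<^sub>R x - tr x *\<^sub>R w)))"
    by (simp add: N_def comm[of _ w])
  also have "\<dots> = (1/2) * (tr w + s * (tr w * tr e - tr w))" by (simp add: traces)
  finally show ?thesis by (simp add: algebra_simps)
qed

lemma trace_N_mult: "lin_trace (\<lambda>x. N s (u \<odot> x) v) = (\<beta> u v + s * tr u * tr v - s * g u v) / 2"
proof -
  have "lin_trace (\<lambda>x. N s (u \<odot> x) v)
      = lin_trace (\<lambda>x. (1/2) *\<^sub>R (v \<odot> (u \<odot> x) + s *\<^sub>R (tr v *\<^sub>R (u \<odot> x) - g u x *\<^sub>R v)))"
    by (simp add: N_def g_def comm[of _ v])
  also have "\<dots> = (1/2) * (\<beta> v u + s * (tr v * tr u - g u v))" by (simp add: traces)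
  finally show ?thesis by (simp add: \<beta>_sym[of v u] algebra_simps)
qed

text \<open>
  Composing the two operators produces multiples of the identity, multiplications and maps of rank
  one; two of the latter have the traces \<open>s g u v\<close> and \<open>- s g u v\<close>, which cancel.
\<close>

lemma trace_N_N:
  "lin_trace (\<lambda>x. N s u (N s x v)) = (\<beta> u v + s * s * (1 - tr e) * tr u * tr v) / 4"
proof -
  have "N s u (N s x v) = (1/4) *\<^sub>R (u \<odot> (v \<odot> x) + (s * tr v) *\<^sub>R (u \<odot> x) - s *\<^sub>R (tr x *\<^sub>R (u \<odot> v))
      + s *\<^sub>R (g v x *\<^sub>R u) - (s * tr u) *\<^sub>R (v \<odot> x) - (s * s * tr u * tr v) *\<^sub>R x
      + (s * s * tr u) *\<^sub>R (tr x *\<^sub>R v))" for x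
  proof -
    have t: "tr (x \<odot> v) = g v x" "x \<odot> v = v \<odot> x" by (simp_all add: g_def comm)
    have trN: "tr (N s x v) = g v x / 2" by (simp add: N_def tr_linear t(1))
    have Nu: "N s u w = (1/2) *\<^sub>R (u \<odot> w + (s * tr w) *\<^sub>R u - (s * tr u) *\<^sub>R w)" for w
      by (simp add: N_def algebra_simps)
    have Nx: "N s x v = (1/2) *\<^sub>R (v \<odot> x + (s * tr v) *\<^sub>R x - (s * tr x) *\<^sub>R v)"
      by (simp add: N_def t(2) algebra_simps)
    show ?thesis
      unfolding Nu[of "N s x v"] trN unfolding Nx by (simp add: distribs algebra_simps)
  qed
  then have "lin_trace (\<lambda>x. N s u (N s x v)) = lin_trace (\<lambda>x. (1/4) *\<^sub>R (u \<odot> (v \<odot> x) + (s * tr v) *\<^sub>R (u \<odot> x)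
      - s *\<^sub>R (tr x *\<^sub>R (u \<odot> v)) + s *\<^sub>R (g v x *\<^sub>R u) - (s * tr u) *\<^sub>R (v \<odot> x)
      - (s * s * tr u * tr v) *\<^sub>R x + (s * s * tr u) *\<^sub>R (tr x *\<^sub>R v)))" by simp
  also have "\<dots> = (1/4) * (\<beta> u v + s * tr v * tr u - s * tr (u \<odot> v) + s * g v u - s * tr u * tr v
      - s * s * tr u * tr v * tr e + s * s * tr u * tr v)"
    by (simp add: traces del: scaleR_scaleR)
  finally show ?thesis by (simp add: g_def comm[of v u] algebra_simps)
qed

lemma ric_h:
  assumes "1 + s * tr e > 0"
  shows "jordan_ric m (h s) u v
    = (\<beta> u v + (2 * s + s * s * (tr e - 1)) * tr u * tr v - (1 + s * (tr e + 1)) * g u v) / 4"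
proof -
  have l: "linear (N s x)" "linear (\<lambda>x. N s x w)" for x w
    using bilinear_N by (simp_all add: bilinear_def)
  have l': "linear (\<lambda>x. N s u (N s x v))" "linear (\<lambda>x. N s (u \<odot> x) v)"
    using linear_compose[OF l(2) l(1)] linear_compose[OF linear_m l(2)] by (simp_all add: o_def)
  have "jordan_curvature m (h s) u x v = N s (u \<odot> x) v - N s u (N s x v) - N s x (N s u v)" for x
    unfolding jordan_curvature_def levi_civita_h[OF assms] Let_def by simp
  then have "jordan_ric m (h s) u v = lin_trace (\<lambda>x. N s (u \<odot> x) v - N s u (N s x v) - N s x (N s u v))"
    unfolding jordan_ric_def by simp
  also have "\<dots> = lin_trace (\<lambda>x. N s (u \<odot> x) v) - lin_trace (\<lambda>x. N s u (N s x v)) - lin_trace (\<lambda>x. N s x (N s u v))"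
    by (simp add: trace_simps l l' linear_compose_sub)
  also have "tr (N s u v) = g u v / 2" by (simp add: N_def tr_linear g_def)
  then have "lin_trace (\<lambda>x. N s x (N s u v)) = (1 + s * (tr e - 1)) / 2 * (g u v / 2)"
    by (simp add: trace_N_left)
  finally show ?thesis by (simp add: trace_N_mult trace_N_N field_simps)
qed

text \<open>
  The coefficients of \<open>g\<close> and \<open>tr \<otimes> tr\<close> in the Ricci form have ratio \<open>1 : s\<close> exactly when
  \<open>(2 s + \<gamma>) (n s + 1) = 0\<close>; the second factor has to be positive.
\<close>

theorem ex_einstein_metric: "\<exists>h. jordan_einstein_metric m h"
proof -
  obtain \<alpha> \<gamma> where b: "\<alpha> \<ge> 0" "\<alpha> + \<gamma> * tr e = 1" "\<And>x y. \<beta> x y = \<alpha> * g x y + \<gamma> * tr x * tr y"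
    by (rule \<beta>_eq) blast
  define s where "s = - \<gamma> / 2"
  have pos: "1 + s * tr e > 0" using b(1,2) by (simp add: s_def)
  have \<gamma>: "\<gamma> = - 2 * s" by (simp add: s_def)
  then have \<alpha>: "\<alpha> = 1 + 2 * s * tr e" using b(2) by (simp add: algebra_simps)
  define k where "k = (\<alpha> - 1 - s * (tr e + 1)) / 4"
  have ric: "jordan_ric m (h s) u v = k * h s u v" for u v
  proof -
    have "4 * jordan_ric m (h s) u v = \<beta> u v + (2 * s + s * s * (tr e - 1)) * tr u * tr v
        - (1 + s * (tr e + 1)) * g u v"
      using ric_h[OF pos, of u v] by simp
    also have "\<dots> = (s * tr e - s) * g u v + (s * s * tr e - s * s) * (tr u * tr v)"
      unfolding b(3) \<alpha> \<gamma> by algebra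
    also have "\<dots> = (\<alpha> - 1 - s * (tr e + 1)) * h s u v"
      unfolding \<alpha> h_def by algebra
    also have "\<alpha> - 1 - s * (tr e + 1) = 4 * k" by (simp add: k_def)
    finally show ?thesis by simp
  qed
  have "jordan_einstein_metric m (h s)"
    unfolding jordan_einstein_metric_def jordan_Ric_def
  proof (intro conjI exI allI)
    show "inner_product (h s)" using pos by (rule inner_product_h)
    show "(jordan_ric m (h s) u v + jordan_ric m (h s) v u) / 2
        = k * h s u v" for u v
      unfolding ric by (simp add: h_def g_sym[of v u] algebra_simps)
  qed
  then show ?thesis by blast
qed

end

theorem theorem5p1:
  fixes m :: "'a::real_vector \<Rightarrow> 'a \<Rightarrow> 'a"
  assumes "fin_dim TYPE('a)"
    and "jordan_algebra m"
    and "simple_algebra m"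
    and "formally_real m"
  shows "\<exists>g. jordan_einstein_metric m g"
proof -
  obtain e where e: "\<And>x. m e x = x" and sq: "\<And>x y. m x x + m y y = 0 \<Longrightarrow> x = 0"
    using assms(4) unfolding formally_real_def by blast
  interpret simple_formally_real_jordan m e
    by unfold_locales (fact assms(1-3) e sq)+
  show ?thesis by (rule ex_einstein_metric)
qed

end
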